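(* Let $\mathfrak{sl}_2=\langle e,f,h\mid [h,e]=2e,\ [h,f]=-2f,\ [e,f]=h\rangle$, a Lie ring additively isomorphic to $\mathbb{Z}^3$. Then for every prime $p$, $$\zeta_{\mathfrak{sl}_2(\mathbb{F}_p)}^{\leq}(s)=1+(1+p)t+(1+p+p^2)t^2+t^3.$$
   Context: A presentation of a Lie ring lists a $\mathbb{Z}$-module basis together with brackets of basis elements; all brackets not listed are zero, up to antisymmetry. For a Lie ring $L\cong\mathbb{Z}^n$ (additively) and a prime $p$, $L(\mathbb{F}_p)=L\otimes_{\mathbb{Z}}\mathbb{F}_p$, and $\zeta_{L(\mathbb{F}_p)}^{\leq}(s)=\sum_{i=0}^{n}a_{p^i}^{\leq}(L(\mathbb{F}_p))\,t^{i}$, where $t=p^{-s}$ and $a_{p^i}^{\leq}(L(\mathbb{F}_p))$ is the number of $\mathbb{F}_p$-Lie subalgebras of $L(\mathbb{F}_p)$ of codimension $i$. *)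

theory Defs
  imports
    "HOL-Algebra.Free_Abelian_Groups"
    "HOL-Algebra.IntRing"
    "HOL-Number_Theory.Residues"
    "HOL-Analysis.Complex_Transcendental"
    "Jordan_Normal_Form.Missing_VectorSpace"
begin

section \<open>Lie algebras\<close>

text \<open>
  As for any \<open>module\<close> record, the inherited ring components \<open>mult\<close> and \<open>one\<close> carry no meaning.
  A Lie ring is a Lie algebra over \<open>\<Z>\<close>.
\<close>

record ('a, 'b) lie_algebra = "('a, 'b) module" +
  lie_bracket :: "'b \<Rightarrow> 'b \<Rightarrow> 'b"

locale lie_algebra = module R L
  for R :: "('a, 'm) ring_scheme" and L :: "('a, 'b, 'n) lie_algebra_scheme" (structure) +
  assumes bracket_closed:
      "\<lbrakk>x \<in> carrier L; y \<in> carrier L\<rbrakk> \<Longrightarrow> lie_bracket L x y \<in> carrier L"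
    and bracket_add_left:
      "\<lbrakk>x \<in> carrier L; y \<in> carrier L; z \<in> carrier L\<rbrakk> \<Longrightarrow>
        lie_bracket L (x \<oplus>\<^bsub>L\<^esub> y) z = lie_bracket L x z \<oplus>\<^bsub>L\<^esub> lie_bracket L y z"
    and bracket_add_right:
      "\<lbrakk>x \<in> carrier L; y \<in> carrier L; z \<in> carrier L\<rbrakk> \<Longrightarrow>
        lie_bracket L x (y \<oplus>\<^bsub>L\<^esub> z) = lie_bracket L x y \<oplus>\<^bsub>L\<^esub> lie_bracket L x z"
    and bracket_smult_left:
      "\<lbrakk>c \<in> carrier R; x \<in> carrier L; y \<in> carrier L\<rbrakk> \<Longrightarrow>
        lie_bracket L (c \<odot>\<^bsub>L\<^esub> x) y = c \<odot>\<^bsub>L\<^esub> lie_bracket L x y"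
    and bracket_smult_right:
      "\<lbrakk>c \<in> carrier R; x \<in> carrier L; y \<in> carrier L\<rbrakk> \<Longrightarrow>
        lie_bracket L x (c \<odot>\<^bsub>L\<^esub> y) = c \<odot>\<^bsub>L\<^esub> lie_bracket L x y"
    and bracket_self: "x \<in> carrier L \<Longrightarrow> lie_bracket L x x = \<zero>\<^bsub>L\<^esub>"
    and jacobi:
      "\<lbrakk>x \<in> carrier L; y \<in> carrier L; z \<in> carrier L\<rbrakk> \<Longrightarrow>
        lie_bracket L x (lie_bracket L y z) \<oplus>\<^bsub>L\<^esub> lie_bracket L y (lie_bracket L z x)
          \<oplus>\<^bsub>L\<^esub> lie_bracket L z (lie_bracket L x y) = \<zero>\<^bsub>L\<^esub>"

definition lie_subalgebra ::
    "('a, 'm) ring_scheme \<Rightarrow> 'b set \<Rightarrow> ('a, 'b, 'n) lie_algebra_scheme \<Rightarrow> bool" where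
  "lie_subalgebra K H L \<longleftrightarrow>
     VectorSpace.subspace K H L \<and> (\<forall>x\<in>H. \<forall>y\<in>H. lie_bracket L x y \<in> H)"

definition lie_subalgebras_of_codim ::
    "('a, 'm) ring_scheme \<Rightarrow> ('a, 'b, 'n) lie_algebra_scheme \<Rightarrow> nat \<Rightarrow> 'b set set" where
  "lie_subalgebras_of_codim K L i =
     {H. lie_subalgebra K H L \<and>
         vectorspace.dim K (L\<lparr>carrier := H\<rparr>) + i = vectorspace.dim K L}"

section \<open>Extension of scalars from the integers\<close>

text \<open>
  \<open>L \<otimes>\<^sub>\<int> K\<close> is the free abelian group on the symbols \<open>(x, a)\<close>, standing for \<open>x \<otimes> a\<close>, modulo
  biadditivity; over the integers this already implies \<open>n x \<otimes> a = x \<otimes> n a\<close>.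
  The structure of a Lie algebra over \<open>K\<close> is given by \<open>c (x \<otimes> a) = x \<otimes> c a\<close> and
  \<open>[x \<otimes> a, y \<otimes> b] = [x, y] \<otimes> a b\<close>.  As for the product of \<^const>\<open>FactRing\<close>, the unions below
  range over all representatives and yield a single coset.
\<close>

definition tensor_relations ::
    "('b, 'm) ring_scheme \<Rightarrow> ('a, 'n) ring_scheme \<Rightarrow> ('b \<times> 'a \<Rightarrow>\<^sub>0 int) set" where
  "tensor_relations L K =
     {frag_of (x \<oplus>\<^bsub>L\<^esub> y, a) - frag_of (x, a) - frag_of (y, a) | x y a.
        x \<in> carrier L \<and> y \<in> carrier L \<and> a \<in> carrier K} \<union>
     {frag_of (x, a \<oplus>\<^bsub>K\<^esub> b) - frag_of (x, a) - frag_of (x, b) | x a b.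
        x \<in> carrier L \<and> a \<in> carrier K \<and> b \<in> carrier K}"

definition extend_scalars ::
    "(int, 'b, 'm) lie_algebra_scheme \<Rightarrow> ('a, 'n) ring_scheme \<Rightarrow>
       ('a, ('b \<times> 'a \<Rightarrow>\<^sub>0 int) set) lie_algebra" where
  "extend_scalars L K =
    (let F = free_Abelian_group (carrier L \<times> carrier K);
         N = generate F (tensor_relations L K)
     in \<lparr>carrier = carrier (F Mod N),
         monoid.mult = undefined,
         one = undefined,
         zero = \<one>\<^bsub>F Mod N\<^esub>,
         add = monoid.mult (F Mod N),
         smult = (\<lambda>c S. \<Union>u\<in>S. N #>\<^bsub>F\<^esub> frag_extend (\<lambda>(x, a). frag_of (x, c \<otimes>\<^bsub>K\<^esub> a)) u),
         lie_bracket = (\<lambda>S T. \<Union>u\<in>S. \<Union>v\<in>T. N #>\<^bsub>F\<^esub>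
           frag_extend (\<lambda>(x, a).
             frag_extend (\<lambda>(y, b). frag_of (lie_bracket L x y, a \<otimes>\<^bsub>K\<^esub> b)) v) u)\<rparr>)"

section \<open>The subalgebra zeta function modulo a prime\<close>

text \<open>
  For \<open>L \<cong> \<int>\<^sup>n\<close> the summation bound is \<open>n\<close>, which is the dimension of \<open>L \<otimes> \<F>\<^sub>p\<close>;
  the coefficient of \<open>t\<^sup>i\<close>, where \<open>t = p\<^sup>-\<^sup>s\<close>, counts the subalgebras of index \<open>p\<^sup>i\<close>.
\<close>

definition subalgebra_zeta_mod ::
    "(int, 'b, 'm) lie_algebra_scheme \<Rightarrow> nat \<Rightarrow> complex \<Rightarrow> complex" where
  "subalgebra_zeta_mod L p s =
    (let K = residue_ring (int p);
         LK = extend_scalars L K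
     in \<Sum>i = 0..vectorspace.dim K LK.
          of_nat (card (lie_subalgebras_of_codim K LK i)) * (of_nat p powr (- s)) ^ i)"

section \<open>Lie rings given by presentations\<close>

text \<open>
  The underlying module is free on the finite type \<open>'b\<close>, an element being its coefficient vector.
  An entry \<open>(i, j, v)\<close> of the list is the relation \<open>[i, j] = v\<close>; it also contributes
  \<open>[j, i] = - v\<close>, and brackets of basis elements that are not listed vanish.  Each unordered
  pair is to be listed at most once.
\<close>

definition presented_lie_ring ::
    "('b::finite \<times> 'b \<times> ('b \<Rightarrow> int)) list \<Rightarrow> (int, 'b \<Rightarrow> int) lie_algebra" where
  "presented_lie_ring rels =
     \<lparr>carrier = UNIV,
      monoid.mult = undefined,
      one = undefined,
      zero = (\<lambda>_. 0),
      add = (\<lambda>x y k. x k + y k),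
      smult = (\<lambda>c x k. c * x k),
      lie_bracket = (\<lambda>x y k. \<Sum>(i, j, v)\<leftarrow>rels. (x i * y j - x j * y i) * v k)\<rparr>"

definition basis_vec :: "'b \<Rightarrow> 'b \<Rightarrow> int" where
  "basis_vec i = (\<lambda>k. if k = i then 1 else 0)"

datatype sl2_gen = gen_e | gen_f | gen_h

lemma UNIV_sl2_gen: "UNIV = {gen_e, gen_f, gen_h}"
  using sl2_gen.exhaust by auto

instance sl2_gen :: finite
  by standard (simp add: UNIV_sl2_gen)

definition sl2 :: "(int, sl2_gen \<Rightarrow> int) lie_algebra" where
  "sl2 = presented_lie_ring
     [(gen_h, gen_e, \<lambda>k. 2 * basis_vec gen_e k),
      (gen_h, gen_f, \<lambda>k. - 2 * basis_vec gen_f k),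
      (gen_e, gen_f, basis_vec gen_h)]"

lemma sl2_brackets:
  "lie_bracket sl2 (basis_vec gen_h) (basis_vec gen_e) = 2 \<odot>\<^bsub>sl2\<^esub> basis_vec gen_e"
  "lie_bracket sl2 (basis_vec gen_h) (basis_vec gen_f) = (- 2) \<odot>\<^bsub>sl2\<^esub> basis_vec gen_f"
  "lie_bracket sl2 (basis_vec gen_e) (basis_vec gen_f) = basis_vec gen_h"
  by (auto simp: sl2_def presented_lie_ring_def basis_vec_def fun_eq_iff)

lemma sl2_lie_ring: "lie_algebra \<Z> sl2"
proof -
  have "abelian_group sl2"
    by (rule abelian_groupI)
      (auto simp: sl2_def presented_lie_ring_def algebra_simps fun_eq_iff
        intro!: exI[where x = "\<lambda>k. - _ k"])
  then have "module \<Z> sl2"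
    by (rule moduleI[OF int_is_cring])
      (auto simp: sl2_def presented_lie_ring_def algebra_simps)
  then show ?thesis
    by (rule lie_algebra.intro)
      (unfold_locales, auto simp: sl2_def presented_lie_ring_def basis_vec_def algebra_simps fun_eq_iff)
qed

lemma sl2_additive_iso:
  "(\<lambda>x. (x gen_e, x gen_f, x gen_h)) \<in>
     iso (add_monoid sl2) (integer_group \<times>\<times> integer_group \<times>\<times> integer_group)"
proof -
  have "\<exists>x. x gen_e = a \<and> x gen_f = b \<and> x gen_h = c" for a b c :: int
    by (rule exI[of _ "case_sl2_gen a b c"]) simp
  then have "surj (\<lambda>x :: sl2_gen \<Rightarrow> int. (x gen_e, x gen_f, x gen_h))"
    unfolding surj_def by (metis prod.exhaust)
  moreover have "inj (\<lambda>x :: sl2_gen \<Rightarrow> int. (x gen_e, x gen_f, x gen_h))"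
    by (rule injI, rule ext) (metis Pair_inject sl2_gen.exhaust)
  ultimately show ?thesis
    by (auto simp: iso_def hom_def bij_betw_def sl2_def presented_lie_ring_def integer_group_def)
qed

end

theory Submission
  imports Defs
begin

text \<open>
  Multiplying by a scalar of \<open>\<F>\<^sub>p\<close> amounts to repeated addition, so \<open>x \<mapsto> x \<otimes> 1\<close> induces
  \<open>L / pL \<cong> L \<otimes> \<F>\<^sub>p\<close>, and subalgebras of \<open>sl\<^sub>2(\<F>\<^sub>p)\<close> correspond to bracket-closed subgroups
  of \<open>\<int>\<^sup>3\<close> containing \<open>p\<int>\<^sup>3\<close>.  Up to swapping and doubling coordinates, the bracket of \<open>sl\<^sub>2\<close>
  is the cross product.  Every line is therefore a subalgebra, and there are \<open>1 + p + p\<^sup>2\<close> of them.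
  Every plane has the form \<open>n\<^sup>\<perp>\<close>, the cross product of two of its vectors is a multiple of \<open>n\<close>,
  and so it is closed under the bracket iff \<open>4 n\<^sub>1 n\<^sub>2 + n\<^sub>3\<^sup>2 = 0\<close>.  This equation has \<open>p + 1\<close>
  projective solutions: a conic for odd \<open>p\<close> and a double line for \<open>p = 2\<close>.
\<close>

section \<open>Extension of scalars to a prime field\<close>

lemma frag_cmul_diff_distrib2: "frag_cmul c (a - b) = frag_cmul c a - frag_cmul c b"
  by (rule poly_mapping_eqI) (simp add: lookup_minus algebra_simps)

lemma frag_extend_fun_diff:
  "frag_extend (\<lambda>i. f i - g i) u = frag_extend f u - frag_extend g u"
  by (simp add: frag_extend_def sum_subtractf frag_cmul_diff_distrib2)

locale lie_ring_mod = lie_algebra \<Z> L for L :: "(int, 'b, 'm) lie_algebra_scheme" (structure) +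
  fixes p :: int
  assumes p_gt_one: "1 < p"
begin

abbreviation K where "K \<equiv> residue_ring p"

abbreviation LK where "LK \<equiv> extend_scalars L K"

definition F where "F = free_Abelian_group (carrier L \<times> carrier K)"

definition N where "N = generate F (tensor_relations L K)"

definition coset where "coset u = N #>\<^bsub>F\<^esub> u"

text \<open>\<open>scale\<close> and \<open>bracket\<close> lift the operations of
  \<open>extend_scalars\<close> to representatives, so that independence of the representative
  becomes a statement about the subgroup \<open>N\<close>.\<close>

definition scale where
  "scale c = frag_extend (\<lambda>(x, a). frag_of (x, c \<otimes>\<^bsub>K\<^esub> a))" for c

definition bracket where
  "bracket u v = frag_extend (\<lambda>(x, a).
     frag_extend (\<lambda>(y, b). frag_of (lie_bracket L x y, a \<otimes>\<^bsub>K\<^esub> b)) v) u" for u v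

sublocale K: residues p K
  using p_gt_one by unfold_locales

section \<open>The free abelian group and its subgroup of biadditivity relations\<close>

interpretation F: comm_group F
  unfolding F_def by (rule abelian_free_Abelian_group)

lemma carrier_F_iff: "u \<in> carrier F \<longleftrightarrow> Poly_Mapping.keys u \<subseteq> carrier L \<times> carrier K"
  by (simp add: F_def)

lemma frag_of_in_F: "\<lbrakk>x \<in> carrier L; a \<in> carrier K\<rbrakk> \<Longrightarrow> frag_of (x, a) \<in> carrier F"
  by (simp add: F_def)

lemma F_simps: "u \<otimes>\<^bsub>F\<^esub> v = u + v" "\<one>\<^bsub>F\<^esub> = 0"
  by (simp_all add: F_def)

lemma F_inv: "u \<in> carrier F \<Longrightarrow> inv\<^bsub>F\<^esub> u = - u"
  by (simp add: F_def)

lemma F_add: "\<lbrakk>u \<in> carrier F; v \<in> carrier F\<rbrakk> \<Longrightarrow> u + v \<in> carrier F"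
  using F.m_closed by (simp add: F_simps)

lemma F_diff: "\<lbrakk>u \<in> carrier F; v \<in> carrier F\<rbrakk> \<Longrightarrow> u - v \<in> carrier F"
  using F.m_closed[of u "- v"] F.inv_closed[of v] by (simp add: F_simps F_inv)

lemma F_induct [consumes 1, case_names zero diff gen]:
  assumes "u \<in> carrier F" "P 0"
    and "\<And>u v. \<lbrakk>u \<in> carrier F; v \<in> carrier F; P u; P v\<rbrakk> \<Longrightarrow> P (u - v)"
    and "\<And>x a. \<lbrakk>x \<in> carrier L; a \<in> carrier K\<rbrakk> \<Longrightarrow> P (frag_of (x, a))"
  shows "P u"
proof (rule free_Abelian_group_induct)
  show "Poly_Mapping.keys u \<subseteq> carrier L \<times> carrier K"
    using assms(1) by (simp only: carrier_F_iff)
  show "P (x - y)" if "Poly_Mapping.keys x \<subseteq> carrier L \<times> carrier K"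
    "Poly_Mapping.keys y \<subseteq> carrier L \<times> carrier K" "P x" "P y" for x y
    using that by (intro assms(3)) (simp_all only: carrier_F_iff)
  show "P (frag_of i)" if "i \<in> carrier L \<times> carrier K" for i
    using that assms(4) by (cases i) blast
qed (rule assms(2))

lemma relations_in_F: "tensor_relations L K \<subseteq> carrier F"
  unfolding tensor_relations_def
  by (auto intro!: F_diff frag_of_in_F simp: K.add.m_closed)

lemma N_subgroup: "subgroup N F"
  unfolding N_def by (rule F.generate_is_subgroup[OF relations_in_F])

lemma N_subset: "u \<in> N \<Longrightarrow> u \<in> carrier F"
  using subgroup.subset[OF N_subgroup] by blast

lemma N_zero: "0 \<in> N"
  using subgroup.one_closed[OF N_subgroup] by (simp add: F_simps)

lemma N_add: "\<lbrakk>u \<in> N; v \<in> N\<rbrakk> \<Longrightarrow> u + v \<in> N"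
  using subgroup.m_closed[OF N_subgroup] by (simp add: F_simps)

lemma N_uminus: "u \<in> N \<Longrightarrow> - u \<in> N"
  using subgroup.m_inv_closed[OF N_subgroup] by (simp add: F_inv N_subset)

lemma N_diff: "\<lbrakk>u \<in> N; v \<in> N\<rbrakk> \<Longrightarrow> u - v \<in> N"
  using N_add[of u "- v"] N_uminus[of v] by simp

lemma N_left_relation:
  "\<lbrakk>x \<in> carrier L; y \<in> carrier L; a \<in> carrier K\<rbrakk> \<Longrightarrow>
    frag_of (x \<oplus> y, a) - frag_of (x, a) - frag_of (y, a) \<in> N"
  unfolding N_def by (rule generate.incl) (auto simp: tensor_relations_def)

lemma N_right_relation:
  "\<lbrakk>x \<in> carrier L; a \<in> carrier K; b \<in> carrier K\<rbrakk> \<Longrightarrow>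
    frag_of (x, a \<oplus>\<^bsub>K\<^esub> b) - frag_of (x, a) - frag_of (x, b) \<in> N"
  unfolding N_def by (rule generate.incl) (auto simp: tensor_relations_def)

text \<open>Reduces a claim that is stable under sums and negatives to the two kinds of biadditivity
  relation.\<close>

lemma N_induct [consumes 1, case_names zero add uminus left right]:
  assumes "u \<in> N" "P 0"
    and "\<And>u v. \<lbrakk>u \<in> N; v \<in> N; P u; P v\<rbrakk> \<Longrightarrow> P (u + v)"
    and "\<And>u. \<lbrakk>u \<in> N; P u\<rbrakk> \<Longrightarrow> P (- u)"
    and "\<And>x y a. \<lbrakk>x \<in> carrier L; y \<in> carrier L; a \<in> carrier K\<rbrakk> \<Longrightarrow>
      P (frag_of (x \<oplus> y, a) - frag_of (x, a) - frag_of (y, a))"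
    and "\<And>x a b. \<lbrakk>x \<in> carrier L; a \<in> carrier K; b \<in> carrier K\<rbrakk> \<Longrightarrow>
      P (frag_of (x, a \<oplus>\<^bsub>K\<^esub> b) - frag_of (x, a) - frag_of (x, b))"
  shows "P u"
  using assms(1) unfolding N_def
proof (induction rule: generate.induct)
  case (incl h)
  then show ?case using assms(5,6) unfolding tensor_relations_def by blast
next
  case (inv h)
  then have "h \<in> N" by (simp add: N_def generate.incl)
  moreover have "P h" using inv assms(5,6) unfolding tensor_relations_def by blast
  ultimately show ?case using assms(4) by (simp add: F_inv N_subset)
next
  case (eng h1 h2)
  then show ?case using assms(3) by (simp add: F_simps N_def)
qed (simp add: F_simps assms(2))

lemma coset_eq_iff: "\<lbrakk>u \<in> carrier F; v \<in> carrier F\<rbrakk> \<Longrightarrow> coset u = coset v \<longleftrightarrow> u - v \<in> N"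
proof
  assume u: "u \<in> carrier F" and v: "v \<in> carrier F"
  assume "coset u = coset v"
  then have "u \<in> coset v" using F.rcos_self[OF u N_subgroup] by (simp add: coset_def)
  then show "u - v \<in> N" by (auto simp: coset_def r_coset_def F_simps)
next
  assume u: "u \<in> carrier F" and v: "v \<in> carrier F" and n: "u - v \<in> N"
  have "u \<in> coset v" using n by (auto simp: coset_def r_coset_def F_simps intro!: bexI[OF _ n])
  then show "coset u = coset v"
    unfolding coset_def using F.repr_independence[OF _ v N_subgroup] by simp
qed

lemma coset_elem: "u' \<in> coset u \<Longrightarrow> \<exists>n\<in>N. u' = n + u"
  by (auto simp: coset_def r_coset_def F_simps)

lemma coset_self: "u \<in> carrier F \<Longrightarrow> u \<in> coset u"
  unfolding coset_def by (rule F.rcos_self[OF _ N_subgroup])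

section \<open>The operations of the tensor product, computed on representatives\<close>

lemma carrier_LK: "carrier LK = coset ` carrier F"
  by (simp add: extend_scalars_def Let_def carrier_FactGroup coset_def[abs_def] F_def N_def)

lemma zero_LK: "\<zero>\<^bsub>LK\<^esub> = coset 0"
  using F.coset_mult_one[OF subgroup.subset[OF N_subgroup]]
  by (simp add: extend_scalars_def Let_def coset_def F_simps flip: F_def N_def)

lemma add_LK:
  assumes "u \<in> carrier F" "v \<in> carrier F"
  shows "coset u \<oplus>\<^bsub>LK\<^esub> coset v = coset (u + v)"
proof -
  have "normal N F" by (rule F.normal_iff_subgroup[THEN iffD2, OF N_subgroup])
  from normal.rcos_sum[OF this assms] show ?thesis
    by (simp add: extend_scalars_def Let_def coset_def F_simps flip: F_def N_def)
qed

lemma scale_diff: "scale c (u - v) = scale c u - scale c v"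
  by (simp add: scale_def frag_extend_diff)

lemma scale_in_F:
  assumes "c \<in> carrier K" "u \<in> carrier F"
  shows "scale c u \<in> carrier F"
  using assms(2)
  by (induction u rule: F_induct)
    (simp_all add: scale_def frag_extend_diff F_diff frag_of_in_F assms(1) carrier_F_iff[of 0])

text \<open>Scaling turns a relation into one of the same kind; for additivity in the scalar this is
  distributivity in the residue ring. Hence scaling is well defined on cosets.\<close>

lemma scale_in_N:
  assumes "c \<in> carrier K" "u \<in> N"
  shows "scale c u \<in> N"
  using assms(2)
proof (induction u rule: N_induct)
  case (left x y a)
  then show ?case
    using assms(1) by (simp add: scale_def frag_extend_diff N_left_relation)
next
  case (right x a b)
  then show ?case
    using assms(1) by (simp add: scale_def frag_extend_diff N_right_relation K.r_distr)
qed (auto simp: scale_def frag_extend_add frag_extend_minus N_zero N_add N_uminus)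

text \<open>By \<open>scale_in_N\<close> every representative yields the same coset, so the union in
  \<open>extend_scalars\<close> is a union of equal sets over a nonempty index set.\<close>

lemma smult_LK:
  assumes "c \<in> carrier K" "u \<in> carrier F"
  shows "c \<odot>\<^bsub>LK\<^esub> coset u = coset (scale c u)"
proof -
  have "coset (scale c u') = coset (scale c u)" if u': "u' \<in> coset u" for u'
  proof -
    obtain n where n: "n \<in> N" "u' = n + u" using coset_elem[OF u'] by blast
    then have "scale c u' - scale c u \<in> N"
      using scale_in_N[OF assms(1) n(1)] by (simp flip: scale_diff)
    with n assms show ?thesis
      by (simp add: coset_eq_iff scale_in_F F_add N_subset)
  qed
  moreover have "c \<odot>\<^bsub>LK\<^esub> coset u = (\<Union>u'\<in>coset u. coset (scale c u'))"
    by (simp add: extend_scalars_def Let_def coset_def scale_def flip: F_def N_def)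
  ultimately show ?thesis
    using UN_constant_eq[OF coset_self[OF assms(2)], of "\<lambda>u'. coset (scale c u')"] by simp
qed

lemma bracket_diff_left: "bracket (u - u') v = bracket u v - bracket u' v"
  by (simp add: bracket_def frag_extend_diff)

text \<open>The second argument sits under the binder of the outer \<open>frag_extend\<close>, so
  additivity is first established at each generator and then carried outward by
  \<open>frag_extend_fun_diff\<close>.\<close>

lemma bracket_diff_right: "bracket u (v - v') = bracket u v - bracket u v'"
proof -
  have "(\<lambda>(x, a). frag_extend (g x a) (v - v')) =
      (\<lambda>i. (case i of (x, a) \<Rightarrow> frag_extend (g x a) v) - (case i of (x, a) \<Rightarrow> frag_extend (g x a) v'))"
    for g :: "'b \<Rightarrow> int \<Rightarrow> 'b \<times> int \<Rightarrow> 'b \<times> int \<Rightarrow>\<^sub>0 int"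
    by (auto simp: frag_extend_diff)
  then show ?thesis unfolding bracket_def by (simp add: frag_extend_fun_diff)
qed

lemma bracket_zero: "bracket 0 v = 0" "bracket u 0 = 0"
  using bracket_diff_right[of u 0 0] by (simp_all add: bracket_def)

lemma bracket_gen:
  "bracket (frag_of (x, a)) (frag_of (y, b)) = frag_of (lie_bracket L x y, a \<otimes>\<^bsub>K\<^esub> b)"
  by (simp add: bracket_def)

lemma bracket_in_F:
  assumes "u \<in> carrier F" "v \<in> carrier F"
  shows "bracket u v \<in> carrier F"
  using assms(1)
proof (induction u rule: F_induct)
  case (gen x a)
  note xa = gen
  show ?case using assms(2)
  proof (induction v rule: F_induct)
    case (gen y b)
    with xa show ?case by (simp add: bracket_gen frag_of_in_F bracket_closed K.m_closed)
  qed (simp_all add: bracket_zero bracket_diff_right F_diff carrier_F_iff[of 0])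
qed (simp_all add: bracket_zero bracket_diff_left F_diff carrier_F_iff[of 0])

lemma bracket_uminus: "bracket (- u) v = - bracket u v" "bracket u (- v) = - bracket u v"
  using bracket_diff_left[of 0 u v] bracket_diff_right[of u 0 v] by (simp_all add: bracket_zero)

lemma bracket_add: "bracket (u + u') v = bracket u v + bracket u' v"
  "bracket u (v + v') = bracket u v + bracket u v'"
  using bracket_diff_left[of u "- u'" v] bracket_diff_right[of u v "- v'"]
  by (simp_all add: bracket_uminus)

text \<open>Additivity reduces the first argument to a generator and the second to a single
  relation. Bracketing a generator with a relation gives a relation of the same kind, because the
  bracket of \<open>L\<close> and the product of \<open>K\<close> are both additive.\<close>

lemma bracket_in_N_right:
  assumes "u \<in> carrier F" "v \<in> N"
  shows "bracket u v \<in> N"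
  using assms(1)
proof (induction u rule: F_induct)
  case (gen x a)
  note xa = gen
  show ?case using assms(2)
  proof (induction v rule: N_induct)
    case (left y z b)
    with xa show ?case
      by (simp add: bracket_gen bracket_diff_right bracket_add_right bracket_closed N_left_relation)
  next
    case (right y b c)
    with xa show ?case
      by (simp add: bracket_gen bracket_diff_right bracket_closed K.r_distr N_right_relation)
  qed (simp_all add: bracket_zero bracket_add bracket_uminus N_zero N_add N_uminus)
qed (simp_all add: bracket_zero bracket_diff_left N_zero N_diff)

lemma bracket_in_N_left:
  assumes "u \<in> N" "v \<in> carrier F"
  shows "bracket u v \<in> N"
  using assms(2)
proof (induction v rule: F_induct)
  case (gen y b)
  note yb = gen
  show ?case using assms(1)
  proof (induction u rule: N_induct)
    case (left x z a)
    with yb show ?case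
      by (simp add: bracket_gen bracket_diff_left bracket_add_left bracket_closed N_left_relation)
  next
    case (right x a c)
    with yb show ?case
      by (simp add: bracket_gen bracket_diff_left bracket_closed K.l_distr N_right_relation)
  qed (simp_all add: bracket_zero bracket_add bracket_uminus N_zero N_add N_uminus)
qed (simp_all add: bracket_zero bracket_diff_right N_zero N_diff)

lemma bracket_LK:
  assumes "u \<in> carrier F" "v \<in> carrier F"
  shows "lie_bracket LK (coset u) (coset v) = coset (bracket u v)"
proof -
  have "coset (bracket u' v') = coset (bracket u v)" if u': "u' \<in> coset u" "v' \<in> coset v" for u' v'
  proof -
    obtain n m where n: "n \<in> N" "u' = n + u" and m: "m \<in> N" "v' = m + v"
      using coset_elem u' by meson
    \<comment> \<open>In each summand on the right, one of the two arguments lies in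
      \<open>N\<close>.\<close>
    have "bracket u' v' - bracket u v = bracket n v' + bracket u m"
      by (simp add: n m bracket_add)
    also have "\<dots> \<in> N"
      using n m assms by (simp add: N_add bracket_in_N_left bracket_in_N_right F_add N_subset)
    finally show ?thesis
      using n m assms by (simp add: coset_eq_iff bracket_in_F F_add N_subset)
  qed
  then have "(\<Union>v'\<in>coset v. coset (bracket u' v')) = coset (bracket u v)" if "u' \<in> coset u" for u'
    using that by (intro UN_constant_eq[OF coset_self[OF assms(2)]]) blast
  then have "(\<Union>u'\<in>coset u. \<Union>v'\<in>coset v. coset (bracket u' v')) = coset (bracket u v)"
    by (intro UN_constant_eq[OF coset_self[OF assms(1)]]) blast
  moreover have "lie_bracket LK (coset u) (coset v) =
      (\<Union>u'\<in>coset u. \<Union>v'\<in>coset v. coset (bracket u' v'))"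
    by (simp add: extend_scalars_def Let_def coset_def bracket_def flip: F_def N_def)
  ultimately show ?thesis by simp
qed

section \<open>Reduction from \<open>L\<close> onto the tensor product, and its kernel\<close>

definition reduce where "reduce x = coset (frag_of (x, 1))"

lemma one_in_K: "1 \<in> carrier K"
  using p_gt_one by (simp add: K.res_carrier_eq)

lemma reduce_in_carrier: "x \<in> carrier L \<Longrightarrow> reduce x \<in> carrier LK"
  by (simp add: reduce_def carrier_LK frag_of_in_F one_in_K)

lemma coset_frag_add_left:
  assumes "x \<in> carrier L" "y \<in> carrier L" "a \<in> carrier K"
  shows "coset (frag_of (x \<oplus> y, a)) = coset (frag_of (x, a)) \<oplus>\<^bsub>LK\<^esub> coset (frag_of (y, a))"
  using N_left_relation[OF assms] assms
  by (simp add: add_LK coset_eq_iff F_add frag_of_in_F diff_diff_eq)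

lemma coset_frag_add_right:
  assumes "x \<in> carrier L" "a \<in> carrier K" "b \<in> carrier K"
  shows "coset (frag_of (x, a \<oplus>\<^bsub>K\<^esub> b)) = coset (frag_of (x, a)) \<oplus>\<^bsub>LK\<^esub> coset (frag_of (x, b))"
  using N_right_relation[OF assms] assms
  by (simp add: add_LK coset_eq_iff F_add frag_of_in_F diff_diff_eq)

lemma reduce_add:
  "\<lbrakk>x \<in> carrier L; y \<in> carrier L\<rbrakk> \<Longrightarrow> reduce (x \<oplus> y) = reduce x \<oplus>\<^bsub>LK\<^esub> reduce y"
  by (simp add: reduce_def coset_frag_add_left one_in_K)

text \<open>For x = y = 0 the left relation collapses to the negative of the generator
  \<open>(\<zero>, 1)\<close>.\<close>

lemma reduce_zero: "reduce \<zero> = \<zero>\<^bsub>LK\<^esub>"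
  using N_uminus[OF N_left_relation[of \<zero> \<zero> 1]]
  by (simp add: reduce_def zero_LK coset_eq_iff one_in_K frag_of_in_F carrier_F_iff[of 0])

lemma coset_frag_zero_right: "x \<in> carrier L \<Longrightarrow> coset (frag_of (x, 0)) = \<zero>\<^bsub>LK\<^esub>"
  using N_uminus[OF N_right_relation[of x 0 0]] K.zero_closed
  by (simp add: zero_LK coset_eq_iff frag_of_in_F carrier_F_iff[of 0] K.res_zero_eq K.res_add_eq)

text \<open>A residue is a sum of ones, and biadditivity moves this sum across the tensor
  sign.\<close>

lemma coset_frag_eq_reduce:
  assumes "x \<in> carrier L" "a \<in> carrier K"
  shows "coset (frag_of (x, a)) = reduce (a \<odot> x)"
proof -
  \<comment> \<open>The bound keeps addition of 1 in the residue ring from wrapping around, so that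
    it agrees with the integer successor.\<close>
  have "int n < p \<Longrightarrow> coset (frag_of (x, int n)) = reduce (int n \<odot> x)" for n
  proof (induction n)
    case 0
    then show ?case
      using assms smult_l_null by (simp add: coset_frag_zero_right reduce_zero)
  next
    case (Suc n)
    then have "int n \<in> carrier K" "int n \<oplus>\<^bsub>K\<^esub> 1 = int (Suc n)"
      by (auto simp: K.res_carrier_eq K.res_add_eq)
    then have "coset (frag_of (x, int (Suc n))) = reduce (int n \<odot> x) \<oplus>\<^bsub>LK\<^esub> reduce x"
      using coset_frag_add_right[OF assms(1), of "int n" 1] Suc
      by (simp add: one_in_K reduce_def)
    also have "\<dots> = reduce (int (Suc n) \<odot> x)"
      using smult_l_distr[of "int n" 1 x] smult_one[of x] assms
      by (simp add: add.commute flip: reduce_add)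
    finally show ?case .
  qed
  from this[of "nat a"] assms(2) show ?thesis
    by (simp add: K.res_carrier_eq)
qed

text \<open>Generators are of the form x \<otimes> 1 by \<open>coset_frag_eq_reduce\<close>, and
  elements of this form are closed under differences. From here on, tensors are handled through
  representatives in \<open>L\<close>.\<close>

lemma carrier_LK_eq_reduce: "carrier LK = reduce ` carrier L"
proof
  have "coset u \<in> reduce ` carrier L" if "u \<in> carrier F" for u
    using that
  proof (induction u rule: F_induct)
    case zero
    then show ?case using reduce_zero zero_LK by (metis M.zero_closed imageI)
  next
    case (diff u v)
    then obtain x y where x: "x \<in> carrier L" "coset u = reduce x"
      and y: "y \<in> carrier L" "coset v = reduce y"
      by blast
    have "u - frag_of (x, 1) \<in> N" "v - frag_of (y, 1) \<in> N"
      using x y diff by (simp_all add: reduce_def coset_eq_iff frag_of_in_F one_in_K)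
    \<comment> \<open>This is the left relation for x = (x - y) + y; combined with the two
      memberships above, it telescopes.\<close>
    moreover have "frag_of (x, 1) - frag_of (x \<ominus> y, 1) - frag_of (y, 1) \<in> N"
      using N_left_relation[of "x \<ominus> y" y 1] x y
      by (simp add: one_in_K M.minus_eq M.a_assoc M.l_neg)
    ultimately have "(u - frag_of (x, 1)) - (v - frag_of (y, 1))
        + (frag_of (x, 1) - frag_of (x \<ominus> y, 1) - frag_of (y, 1)) \<in> N"
      by (meson N_add N_diff)
    then have "u - v - frag_of (x \<ominus> y, 1) \<in> N"
      by (simp add: algebra_simps)
    then have "coset (u - v) = reduce (x \<ominus> y)"
      using x y diff by (simp add: reduce_def coset_eq_iff F_diff frag_of_in_F one_in_K)
    then show ?case using x y by blast
  next
    case (gen x a)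
    then show ?case by (simp add: coset_frag_eq_reduce)
  qed
  then show "carrier LK \<subseteq> reduce ` carrier L"
    by (auto simp: carrier_LK)
qed (auto simp: reduce_in_carrier)

lemma reduce_smult:
  assumes "c \<in> carrier K" "x \<in> carrier L"
  shows "reduce (c \<odot> x) = c \<odot>\<^bsub>LK\<^esub> reduce x"
proof -
  have "c \<odot>\<^bsub>LK\<^esub> reduce x = coset (scale c (frag_of (x, 1)))"
    unfolding reduce_def using assms by (simp add: smult_LK frag_of_in_F one_in_K)
  also have "scale c (frag_of (x, 1)) = frag_of (x, c)"
    using assms K.r_one by (simp add: scale_def K.res_one_eq)
  finally show ?thesis using assms by (simp add: coset_frag_eq_reduce)
qed

lemma reduce_bracket:
  assumes "x \<in> carrier L" "y \<in> carrier L"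
  shows "reduce (lie_bracket L x y) = lie_bracket LK (reduce x) (reduce y)"
  using assms K.r_one[of 1]
  by (simp add: reduce_def bracket_LK bracket_gen frag_of_in_F one_in_K K.res_one_eq)

text \<open>In the residue ring (p - 1) + 1 = 0, while by additivity z \<otimes> ((p - 1) + 1) is
  the reduction of (p - 1) z + z = p z.\<close>

lemma reduce_p_smult:
  assumes "z \<in> carrier L"
  shows "reduce (p \<odot> z) = \<zero>\<^bsub>LK\<^esub>"
proof -
  have "p - 1 \<in> carrier K" "(p - 1) \<oplus>\<^bsub>K\<^esub> 1 = 0"
    using p_gt_one by (simp_all add: K.res_carrier_eq K.res_add_eq)
  then have "reduce ((p - 1) \<odot> z) \<oplus>\<^bsub>LK\<^esub> reduce z = \<zero>\<^bsub>LK\<^esub>"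
    using coset_frag_add_right[of z "p - 1" 1] coset_frag_eq_reduce[of z "p - 1"] assms
    by (simp add: one_in_K coset_frag_zero_right reduce_def)
  then show ?thesis
    using smult_l_distr[of "p - 1" 1 z] smult_one[of z] assms by (simp flip: reduce_add)
qed

text \<open>Evaluation x \<otimes> a \<mapsto> a x is well defined only modulo p, since a is a
  residue. It kills the relations of the first kind and sends those of the second kind to multiples
  of p, which bounds the kernel of \<open>reduce\<close> from above.\<close>

lemma N_eval:
  assumes h: "h \<in> hom F (add_monoid L)"
    and h_gen: "\<And>x a. \<lbrakk>x \<in> carrier L; a \<in> carrier K\<rbrakk> \<Longrightarrow> h (frag_of (x, a)) = a \<odot> x"
    and u: "u \<in> N"
  shows "\<exists>z\<in>carrier L. h u = p \<odot> z"
proof -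
  interpret h: group_hom F "add_monoid L" h
    using h by (simp add: group_hom_def group_hom_axioms_def F.is_group M.a_group)
  have h_add: "h (u + v) = h u \<oplus> h v" if "u \<in> carrier F" "v \<in> carrier F" for u v
    using h.hom_mult[OF that] by (simp add: F_simps)
  have h_uminus: "h (- u) = \<ominus> h u" if "u \<in> carrier F" for u
    using h.hom_inv[OF that] that by (simp add: F_inv a_inv_def)
  have h_diff: "h (u - v) = h u \<ominus> h v" if "u \<in> carrier F" "v \<in> carrier F" for u v
    using h_add[of u "- v"] that F.inv_closed[of v] by (simp add: h_uminus F_inv M.minus_eq)
  show ?thesis using u
  proof (induction u rule: N_induct)
    case zero
    have "h 0 = \<zero>" using h.hom_one by (simp add: F_simps)
    then show ?case using smult_r_null[of p] by (intro bexI[of _ \<zero>]) simp_all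
  next
    case (add u v)
    then obtain y z where "y \<in> carrier L" "h u = p \<odot> y" "z \<in> carrier L" "h v = p \<odot> z" by blast
    with add show ?case by (intro bexI[of _ "y \<oplus> z"]) (simp_all add: h_add N_subset smult_r_distr)
  next
    case (uminus u)
    then obtain y where "y \<in> carrier L" "h u = p \<odot> y" by blast
    with uminus show ?case
      by (intro bexI[of _ "\<ominus> y"]) (simp_all add: h_uminus N_subset smult_r_minus)
  next
    case (left x y a)
    then have "h (frag_of (x \<oplus> y, a) - frag_of (x, a) - frag_of (y, a)) = \<zero>"
      using M.r_neg[of "a \<odot> x \<oplus> a \<odot> y"]
      by (simp add: h_diff h_gen frag_of_in_F F_diff smult_r_distr M.minus_eq M.minus_add M.a_assoc)
    then show ?case using smult_r_null[of p] by (intro bexI[of _ \<zero>]) simp_all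
  next
    case (right x a b)
    then have "h (frag_of (x, a \<oplus>\<^bsub>K\<^esub> b) - frag_of (x, a) - frag_of (x, b))
        = ((a + b) mod p) \<odot> x \<ominus> a \<odot> x \<ominus> b \<odot> x"
      by (simp add: h_diff h_gen frag_of_in_F F_diff K.res_add_eq)
    also have "\<dots> = ((a + b) mod p - a - b) \<odot> x"
      using right smult_l_distr[of "(a + b) mod p - a" "- b" x] smult_l_distr[of "(a + b) mod p" "- a" x]
        smult_l_minus[of a x] smult_l_minus[of b x] by (simp add: M.minus_eq int_a_inv_eq)
    \<comment> \<open>The discrepancy is the carry of the addition of residues, a multiple of
      p.\<close>
    also have "(a + b) mod p - a - b = p * (- ((a + b) div p))"
      by (simp add: minus_div_mult_eq_mod[symmetric] algebra_simps)
    also have "\<dots> \<odot> x = p \<odot> ((- ((a + b) div p)) \<odot> x)"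
      using smult_assoc1[of p "- ((a + b) div p)" x] right by simp
    finally show ?case using right by (intro bexI[of _ "(- ((a + b) div p)) \<odot> x"]) simp_all
  qed
qed

text \<open>Identifies the kernel of reduction with pL. Forward, the universal property of the free
  abelian group supplies the evaluation that \<open>N_eval\<close> speaks of; backward,
  \<open>reduce_p_smult\<close> applies.\<close>

lemma reduce_eq_iff:
  assumes "x \<in> carrier L" "y \<in> carrier L"
  shows "reduce x = reduce y \<longleftrightarrow> (\<exists>z\<in>carrier L. x = y \<oplus> p \<odot> z)"
proof
  assume "reduce x = reduce y"
  then have N: "frag_of (x, 1) - frag_of (y, 1) \<in> N"
    using assms by (simp add: reduce_def coset_eq_iff frag_of_in_F one_in_K)
  obtain h where h: "h \<in> hom F (add_monoid L)"
    and h_gen: "\<And>i. i \<in> carrier L \<times> carrier K \<Longrightarrow> h (frag_of i) = (case i of (x, a) \<Rightarrow> a \<odot> x)"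
    unfolding F_def
    by (rule comm_group.free_Abelian_group_universal[OF M.a_comm_group,
          of "\<lambda>(x, a). a \<odot> x" "carrier L \<times> carrier K"]) auto
  obtain z where z: "z \<in> carrier L" "h (frag_of (x, 1) - frag_of (y, 1)) = p \<odot> z"
    using N_eval[OF h _ N] h_gen by auto
  have "h (frag_of (x, 1) - frag_of (y, 1) + frag_of (y, 1))
      = h (frag_of (x, 1) - frag_of (y, 1)) \<oplus> h (frag_of (y, 1))"
    using hom_mult[OF h N_subset[OF N] frag_of_in_F[OF assms(2) one_in_K]] by (simp add: F_simps)
  then have "x = p \<odot> z \<oplus> y"
    using assms h_gen z smult_one[of x] smult_one[of y] by (simp add: one_in_K)
  then show "\<exists>z\<in>carrier L. x = y \<oplus> p \<odot> z"
    using z assms M.a_comm by auto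
next
  assume "\<exists>z\<in>carrier L. x = y \<oplus> p \<odot> z"
  then obtain z where z: "z \<in> carrier L" "x = y \<oplus> p \<odot> z" by blast
  have "reduce x = reduce y \<oplus>\<^bsub>LK\<^esub> reduce \<zero>"
    using z assms by (simp add: reduce_add reduce_p_smult reduce_zero)
  also have "\<dots> = reduce (y \<oplus> \<zero>)"
    using assms by (simp only: reduce_add M.zero_closed)
  finally show "reduce x = reduce y"
    using assms by simp
qed

text \<open>Primality makes the residue ring a field. The module laws are transported from
  \<open>L\<close> along the surjection \<open>reduce\<close>.\<close>

lemma vectorspace_LK:
  assumes "prime p"
  shows "vectorspace K LK"
proof (rule vs_criteria)
  have "prime (nat p)"
    using assms by (simp only: prime_int_nat_transfer)
  then have "residues_prime (nat p)"
    by (rule residues_prime.intro)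
  from residues_prime.is_field[OF this] show "field K"
    using p_gt_one by simp
  have K_simps: "carrier K = {0..p - 1}" "\<And>a b. a \<oplus>\<^bsub>K\<^esub> b = (a + b) mod p"
    "\<And>a b. a \<otimes>\<^bsub>K\<^esub> b = (a * b) mod p" "\<one>\<^bsub>K\<^esub> = 1"
    by (simp_all add: K.res_carrier_eq K.res_add_eq K.res_mult_eq K.res_one_eq)
  \<comment> \<open>Sums and products of scalars in \<open>K\<close> are taken modulo p, so the laws
    that combine two scalars transport only once integer coefficients may be replaced by
    residues.\<close>
  have mod: "reduce ((a mod p) \<odot> x) = reduce (a \<odot> x)" if x: "x \<in> carrier L" for a x
  proof -
    have "a \<odot> x = (a mod p) \<odot> x \<oplus> p \<odot> ((a div p) \<odot> x)"
      using x smult_l_distr[of "a mod p" "p * (a div p)" x] smult_assoc1[of p "a div p" x] by simp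
    then have "reduce (a \<odot> x) = reduce ((a mod p) \<odot> x)"
      using x by (subst reduce_eq_iff) auto
    then show ?thesis by simp
  qed
  show "\<zero>\<^bsub>LK\<^esub> \<in> carrier LK"
    using reduce_zero reduce_in_carrier[of \<zero>] by simp
  show "\<forall>v w. v \<in> carrier LK \<and> w \<in> carrier LK \<longrightarrow> v \<oplus>\<^bsub>LK\<^esub> w \<in> carrier LK"
    by (auto simp: carrier_LK_eq_reduce simp flip: reduce_add)
  show "\<forall>v\<in>carrier LK. \<exists>w\<in>carrier LK. v \<oplus>\<^bsub>LK\<^esub> w = \<zero>\<^bsub>LK\<^esub>"
  proof
    fix v assume "v \<in> carrier LK"
    then obtain x where x: "x \<in> carrier L" "v = reduce x" by (auto simp: carrier_LK_eq_reduce)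
    then have "v \<oplus>\<^bsub>LK\<^esub> reduce (\<ominus> x) = \<zero>\<^bsub>LK\<^esub>"
      by (simp add: M.r_neg flip: reduce_add reduce_zero)
    then show "\<exists>w\<in>carrier LK. v \<oplus>\<^bsub>LK\<^esub> w = \<zero>\<^bsub>LK\<^esub>"
      using x by (intro bexI[of _ "reduce (\<ominus> x)"]) (simp_all add: reduce_in_carrier)
  qed
  show "\<forall>c v. c \<in> carrier K \<and> v \<in> carrier LK \<longrightarrow> c \<odot>\<^bsub>LK\<^esub> v \<in> carrier LK"
    by (auto simp: carrier_LK_eq_reduce simp flip: reduce_smult)
  show "\<forall>v w. v \<in> carrier LK \<and> w \<in> carrier LK \<longrightarrow> v \<oplus>\<^bsub>LK\<^esub> w = w \<oplus>\<^bsub>LK\<^esub> v"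
    by (auto simp: carrier_LK_eq_reduce M.a_comm simp flip: reduce_add)
  show "\<forall>v w x. v \<in> carrier LK \<and> w \<in> carrier LK \<and> x \<in> carrier LK \<longrightarrow>
      (v \<oplus>\<^bsub>LK\<^esub> w) \<oplus>\<^bsub>LK\<^esub> x = v \<oplus>\<^bsub>LK\<^esub> (w \<oplus>\<^bsub>LK\<^esub> x)"
    by (auto simp: carrier_LK_eq_reduce M.a_assoc simp flip: reduce_add)
  show "\<forall>v\<in>carrier LK. v \<oplus>\<^bsub>LK\<^esub> \<zero>\<^bsub>LK\<^esub> = v"
    by (auto simp: carrier_LK_eq_reduce simp flip: reduce_add reduce_zero)
  show "\<forall>a b v. a \<in> carrier K \<and> b \<in> carrier K \<and> v \<in> carrier LK \<longrightarrow>
      (a \<otimes>\<^bsub>K\<^esub> b) \<odot>\<^bsub>LK\<^esub> v = a \<odot>\<^bsub>LK\<^esub> (b \<odot>\<^bsub>LK\<^esub> v)"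
  proof (intro allI impI)
    fix a b v assume H: "a \<in> carrier K \<and> b \<in> carrier K \<and> v \<in> carrier LK"
    then obtain x where x: "x \<in> carrier L" "v = reduce x" by (auto simp: carrier_LK_eq_reduce)
    have "(a \<otimes>\<^bsub>K\<^esub> b) \<odot>\<^bsub>LK\<^esub> v = reduce ((a * b) \<odot> x)"
      using x H K.m_closed[of a b] by (simp add: K_simps(3) mod flip: reduce_smult)
    also have "\<dots> = a \<odot>\<^bsub>LK\<^esub> (b \<odot>\<^bsub>LK\<^esub> v)"
      using x H smult_assoc1[of a b x] by (simp flip: reduce_smult)
    finally show "(a \<otimes>\<^bsub>K\<^esub> b) \<odot>\<^bsub>LK\<^esub> v = a \<odot>\<^bsub>LK\<^esub> (b \<odot>\<^bsub>LK\<^esub> v)" .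
  qed
  show "\<forall>v\<in>carrier LK. \<one>\<^bsub>K\<^esub> \<odot>\<^bsub>LK\<^esub> v = v"
    using smult_one one_in_K by (auto simp: carrier_LK_eq_reduce K_simps(4) simp flip: reduce_smult)
  show "\<forall>a b v. a \<in> carrier K \<and> b \<in> carrier K \<and> v \<in> carrier LK \<longrightarrow>
      (a \<oplus>\<^bsub>K\<^esub> b) \<odot>\<^bsub>LK\<^esub> v = (a \<odot>\<^bsub>LK\<^esub> v) \<oplus>\<^bsub>LK\<^esub> (b \<odot>\<^bsub>LK\<^esub> v)"
  proof (intro allI impI)
    fix a b v assume H: "a \<in> carrier K \<and> b \<in> carrier K \<and> v \<in> carrier LK"
    then obtain x where x: "x \<in> carrier L" "v = reduce x" by (auto simp: carrier_LK_eq_reduce)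
    have "(a \<oplus>\<^bsub>K\<^esub> b) \<odot>\<^bsub>LK\<^esub> v = reduce ((a + b) \<odot> x)"
      using x H K.add.m_closed[of a b] by (simp add: K_simps(2) mod flip: reduce_smult)
    also have "\<dots> = (a \<odot>\<^bsub>LK\<^esub> v) \<oplus>\<^bsub>LK\<^esub> (b \<odot>\<^bsub>LK\<^esub> v)"
      using x H smult_l_distr[of a b x] by (simp flip: reduce_smult reduce_add)
    finally show "(a \<oplus>\<^bsub>K\<^esub> b) \<odot>\<^bsub>LK\<^esub> v = (a \<odot>\<^bsub>LK\<^esub> v) \<oplus>\<^bsub>LK\<^esub> (b \<odot>\<^bsub>LK\<^esub> v)" .
  qed
  show "\<forall>a v w. a \<in> carrier K \<and> v \<in> carrier LK \<and> w \<in> carrier LK \<longrightarrow>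
      a \<odot>\<^bsub>LK\<^esub> (v \<oplus>\<^bsub>LK\<^esub> w) = (a \<odot>\<^bsub>LK\<^esub> v) \<oplus>\<^bsub>LK\<^esub> (a \<odot>\<^bsub>LK\<^esub> w)"
    by (auto simp: carrier_LK_eq_reduce smult_r_distr simp flip: reduce_smult reduce_add)
qed

end

text \<open>Vectors correspond to coefficient functions on a basis, made unique by extensionality.
  This trades dimensions for cardinalities, which are what the count below works with.\<close>

lemma (in vectorspace) card_carrier_eq_power_dim:
  assumes "finite (carrier V)"
  shows "card (carrier V) = card (carrier K) ^ dim"
proof -
  have "gen_set (carrier V)"
    using in_own_span span_closed by blast
  then obtain B where B: "finite B" "basis B"
    using finite_basis_exists assms unfolding fin_dim_def by blast
  then have sub: "B \<subseteq> carrier V" by (simp add: basis_def)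
  have *: "\<exists>!a. a \<in> B \<rightarrow>\<^sub>E carrier K \<and> lincomb a B = v" if "v \<in> carrier V" for v
    using basis_criterion[OF B(1) sub] B(2) that by blast
  have "bij_betw (\<lambda>a. lincomb a B) (B \<rightarrow>\<^sub>E carrier K) (carrier V)"
  proof (rule bij_betwI')
    fix a b assume a: "a \<in> B \<rightarrow>\<^sub>E carrier K" and b: "b \<in> B \<rightarrow>\<^sub>E carrier K"
    have "lincomb a B \<in> carrier V"
      using sub a by (intro lincomb_closed) auto
    from *[OF this] a b show "lincomb a B = lincomb b B \<longleftrightarrow> a = b" by metis
  next
    fix a assume "a \<in> B \<rightarrow>\<^sub>E carrier K"
    then show "lincomb a B \<in> carrier V" using sub by (intro lincomb_closed) auto
  next
    fix v assume "v \<in> carrier V"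
    from *[OF this] show "\<exists>a\<in>B \<rightarrow>\<^sub>E carrier K. v = lincomb a B" by metis
  qed
  then have "card (carrier V) = card (B \<rightarrow>\<^sub>E carrier K)"
    by (simp add: bij_betw_same_card)
  also have "\<dots> = card (carrier K) ^ dim"
    using B by (simp add: card_PiE dim_basis)
  finally show ?thesis .
qed

section \<open>Subspaces of a three-dimensional space over a prime field\<close>

type_synonym vec3 = "int \<times> int \<times> int"

fun scale3 :: "int \<Rightarrow> vec3 \<Rightarrow> vec3" where
  "scale3 c (x, y, z) = (c * x, c * y, c * z)"

fun dot3 :: "vec3 \<Rightarrow> vec3 \<Rightarrow> int" where
  "dot3 (a, b, c) (x, y, z) = a * x + b * y + c * z"

fun cross :: "vec3 \<Rightarrow> vec3 \<Rightarrow> vec3" where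
  "cross (a, b, c) (x, y, z) = (b * z - c * y, c * x - a * z, a * y - b * x)"

locale prime_modulus =
  fixes p :: int
  assumes prime_p: "prime p"
begin

abbreviation I where "I \<equiv> {0..<p}"

abbreviation reps where "reps \<equiv> I \<times> I \<times> I"

fun red :: "vec3 \<Rightarrow> vec3" where
  "red (x, y, z) = (x mod p, y mod p, z mod p)"

text \<open>A subspace of the three-dimensional space over \<F>_p, encoded as its full preimage in
  \<int>^3. The last clause says that this preimage contains p\<int>^3, and it also excludes the
  empty set.\<close>

definition submod :: "vec3 set \<Rightarrow> bool" where
  "submod T \<longleftrightarrow> (\<forall>u\<in>T. \<forall>v\<in>T. u + v \<in> T) \<and> (\<forall>c. \<forall>v\<in>T. scale3 c v \<in> T) \<and>
     (\<forall>v. scale3 p v \<in> T)"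

text \<open>For a \<open>submod\<close> this is the number of elements of the subspace, as the box
  contains one vector of each residue class.\<close>

definition size_mod :: "vec3 set \<Rightarrow> nat" where
  "size_mod T = card (T \<inter> reps)"

text \<open>The condition modulo p makes the line a union of residue classes. In particular
  \<open>line (0, 0, 0)\<close> is p\<int>^3, which stands for the zero subspace.\<close>

definition line :: "vec3 \<Rightarrow> vec3 set" where
  "line v = {w. \<exists>c. red w = red (scale3 c v)}"

definition perp :: "vec3 \<Rightarrow> vec3 set" where
  "perp n = {v. p dvd dot3 n v}"

text \<open>One representative of each line through the origin: the first nonzero entry is \<open>1\<close>.\<close>

definition normalized :: "vec3 set" where
  "normalized = {1} \<times> I \<times> I \<union> {0} \<times> {1} \<times> I \<union> {(0, 0, 1)}"

section \<open>Residue classes and submodules that are unions of them\<close>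

lemma p_gt_one: "1 < p"
  using prime_p prime_gt_1_int by blast

lemma p_pos: "0 < p"
  using p_gt_one by simp

lemma inverse_mod_exists:
  assumes "\<not> p dvd a"
  obtains e where "p dvd e * a - 1"
proof -
  have "coprime a p"
    using assms prime_p by (metis coprime_commute prime_imp_coprime)
  then obtain e where "[a * e = 1] (mod p)"
    using cong_solve_coprime_int by blast
  then show ?thesis
    using that[of e] by (simp add: cong_iff_dvd_diff mult.commute)
qed

lemma dvd_diff_I: "\<lbrakk>a \<in> I; b \<in> I; p dvd a - b\<rbrakk> \<Longrightarrow> a = b"
  by (metis atLeastLessThan_iff mod_eq_dvd_iff mod_pos_pos_trivial)

lemma red_eq_iff:
  "red (x, y, z) = red (x', y', z') \<longleftrightarrow> p dvd x - x' \<and> p dvd y - y' \<and> p dvd z - z'"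
  by (simp add: mod_eq_dvd_iff)

lemma red_in_box: "red v \<in> reps"
  using p_pos by (cases v) simp

lemma red_box: "v \<in> reps \<Longrightarrow> red v = v"
  by (cases v) simp

lemma red_red [simp]: "red (red v) = red v"
  by (cases v) simp

lemma finite_size: "finite (T \<inter> reps)"
  by simp

lemma submod_red_eq:
  assumes "submod T" "red u = red v" "u \<in> T"
  shows "v \<in> T"
proof -
  obtain x y z x' y' z' where uv: "u = (x, y, z)" "v = (x', y', z')"
    by (metis prod.exhaust)
  then have "p dvd x' - x" "p dvd y' - y" "p dvd z' - z"
    using assms(2) red_eq_iff[of x' y' z' x y z] by simp_all
  then obtain a b c where "x' = x + p * a" "y' = y + p * b" "z' = z + p * c"
    by (metis diff_eq_eq add.commute dvdE)
  then have "v = u + scale3 p (a, b, c)"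
    by (simp add: uv)
  then show ?thesis
    using assms(1,3) by (simp add: submod_def del: scale3.simps)
qed

lemma submod_red_iff: "submod T \<Longrightarrow> red v \<in> T \<longleftrightarrow> v \<in> T"
  using submod_red_eq red_red by metis

lemma submod_eq_iff:
  assumes "submod S" "submod T"
  shows "S = T \<longleftrightarrow> S \<inter> reps = T \<inter> reps"
  using submod_red_iff[OF assms(1)] submod_red_iff[OF assms(2)] red_in_box
  by (metis IntD1 IntI subsetI subset_antisym)

text \<open>Plays the role of comparing dimensions: an inclusion of finite sets of representatives
  with the reverse inequality of cardinalities is an equality.\<close>

lemma submod_eqI:
  assumes "submod S" "submod T" "S \<subseteq> T" "size_mod T \<le> size_mod S"
  shows "S = T"
  using assms(3,4) card_seteq[OF finite_size[of T], of "S \<inter> reps"]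
  by (auto simp: submod_eq_iff[OF assms(1,2)] size_mod_def)

lemma submod_zero: "submod T \<Longrightarrow> (0, 0, 0) \<in> T"
  by (metis mult_zero_left mult_zero_right scale3.simps submod_def)

lemma submod_unscale:
  assumes "submod T" "scale3 a w \<in> T" "\<not> p dvd a"
  shows "w \<in> T"
proof -
  obtain e where e: "p dvd e * a - 1" using inverse_mod_exists assms(3) by blast
  have "scale3 e (scale3 a w) \<in> T" using assms by (simp add: submod_def)
  moreover have "red (scale3 e (scale3 a w)) = red w"
  proof (cases w)
    case (fields x y z)
    have "p dvd e * (a * t) - t" for t
      using dvd_mult2[OF e, of t] by (simp add: algebra_simps)
    then show ?thesis
      unfolding fields scale3.simps red_eq_iff by blast
  qed
  ultimately show ?thesis using submod_red_eq assms(1) by blast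
qed

section \<open>Lines and their normalized representatives\<close>

lemma submod_line: "submod (line v)"
proof -
  obtain a b c where v: "v = (a, b, c)" by (metis prod.exhaust)
  have mem: "(x, y, z) \<in> line v \<longleftrightarrow> (\<exists>k. p dvd x - k * a \<and> p dvd y - k * b \<and> p dvd z - k * c)"
    for x y z
    by (simp only: v line_def mem_Collect_eq scale3.simps red_eq_iff)
  have "u + w \<in> line v" if "u \<in> line v" "w \<in> line v" for u w
  proof -
    obtain x y z x' y' z' where uw: "u = (x, y, z)" "w = (x', y', z')" by (metis prod.exhaust)
    obtain k where k: "p dvd x - k * a" "p dvd y - k * b" "p dvd z - k * c"
      using \<open>u \<in> line v\<close> uw mem by blast
    obtain l where l: "p dvd x' - l * a" "p dvd y' - l * b" "p dvd z' - l * c"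
      using \<open>w \<in> line v\<close> uw mem by blast
    have "p dvd (x + x') - (k + l) * a" "p dvd (y + y') - (k + l) * b" "p dvd (z + z') - (k + l) * c"
      using dvd_add[OF k(1) l(1)] dvd_add[OF k(2) l(2)] dvd_add[OF k(3) l(3)]
      by (simp_all add: algebra_simps)
    then show ?thesis using mem uw by auto
  qed
  moreover have "scale3 d u \<in> line v" if "u \<in> line v" for d u
  proof -
    obtain x y z where u: "u = (x, y, z)" by (metis prod.exhaust)
    obtain k where k: "p dvd x - k * a" "p dvd y - k * b" "p dvd z - k * c"
      using \<open>u \<in> line v\<close> u mem by blast
    have "p dvd d * x - (d * k) * a" "p dvd d * y - (d * k) * b" "p dvd d * z - (d * k) * c"
      using k[THEN dvd_mult[of _ _ d]] by (simp_all add: algebra_simps)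
    then show ?thesis using mem u by auto
  qed
  moreover have "scale3 p u \<in> line v" for u
  proof (cases u)
    case (fields x y z)
    show ?thesis unfolding fields scale3.simps mem by (rule exI[of _ 0]) simp
  qed
  ultimately show ?thesis unfolding submod_def by blast
qed

lemma submod_perp: "submod (perp n)"
proof -
  have "dot3 n (u + v) = dot3 n u + dot3 n v" "dot3 n (scale3 c u) = c * dot3 n u" for u v c
    by (cases n; cases u; cases v; simp add: algebra_simps)+
  then show ?thesis
    by (auto simp: submod_def perp_def)
qed

lemma line_subset:
  assumes "submod T" "v \<in> T"
  shows "line v \<subseteq> T"
proof
  fix w assume "w \<in> line v"
  then obtain c where "red (scale3 c v) = red w" by (auto simp: line_def)
  moreover have "scale3 c v \<in> T" using assms by (simp add: submod_def)
  ultimately show "w \<in> T" using submod_red_eq assms(1) by blast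
qed

lemma line_self: "v \<in> line v"
  unfolding line_def by (rule CollectI, rule exI[of _ 1]) (cases v, simp)

lemma zero_line: "(x, y, z) \<in> line (0, 0, 0) \<longleftrightarrow> p dvd x \<and> p dvd y \<and> p dvd z"
  by (simp add: line_def mod_eq_0_iff_dvd)

lemma normalized_nonzero: "v \<in> normalized \<Longrightarrow> v \<notin> line (0, 0, 0)"
  using p_gt_one zdvd_not_zless[of 1 p] by (cases v) (auto simp: normalized_def zero_line)

lemma normalized_box: "normalized \<subseteq> reps"
  using p_gt_one by (auto simp: normalized_def)

text \<open>Take a vector of \<open>T\<close> that is nonzero modulo p, multiply it by an inverse of
  its first entry not divisible by p, and reduce.\<close>

lemma normalized_mem:
  assumes "submod T" "\<not> T \<subseteq> line (0, 0, 0)"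
  obtains v where "v \<in> T" "v \<in> normalized"
proof -
  obtain x y z where xyz: "(x, y, z) \<in> T" "(x, y, z) \<notin> line (0, 0, 0)"
    using assms(2) by (metis prod.exhaust subsetI)
  have *: "red (scale3 e (x, y, z)) \<in> T" for e
    using assms(1) xyz(1) by (simp add: submod_red_iff submod_def del: scale3.simps)
  have one: "(e * a) mod p = 1" if "p dvd e * a - 1" for e a
    using that p_gt_one mod_eq_dvd_iff[of "e * a" p 1] by simp
  have zero: "(e * a) mod p = 0" if "p dvd a" for e a
    using that by simp
  have I: "a mod p \<in> I" for a using p_pos by simp
  consider "\<not> p dvd x" | "p dvd x" "\<not> p dvd y" | "p dvd x" "p dvd y" "\<not> p dvd z"
    using xyz(2) zero_line by blast
  then show ?thesis
  proof cases
    case 1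
    then obtain e where "p dvd e * x - 1" using inverse_mod_exists by blast
    then show ?thesis using that[OF *[of e]] I by (simp add: normalized_def one)
  next
    case 2
    then obtain e where "p dvd e * y - 1" using inverse_mod_exists by blast
    then show ?thesis using that[OF *[of e]] I 2 by (simp add: normalized_def one)
  next
    case 3
    then obtain e where "p dvd e * z - 1" using inverse_mod_exists by blast
    then show ?thesis using that[OF *[of e]] 3 by (simp add: normalized_def one)
  qed
qed

text \<open>The multiples of \<open>v\<close> by residues are pairwise incongruent: from c v = d v
  modulo p with c \<noteq> d, cancelling c - d would make \<open>v\<close> zero.\<close>

lemma size_line:
  assumes "v \<in> normalized"
  shows "size_mod (line v) = nat p"
proof -
  have "bij_betw (\<lambda>c. red (scale3 c v)) I (line v \<inter> reps)"
  proof (rule bij_betwI')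
    fix c d assume cd: "c \<in> I" "d \<in> I"
    show "red (scale3 c v) = red (scale3 d v) \<longleftrightarrow> c = d"
    proof
      assume *: "red (scale3 c v) = red (scale3 d v)"
      show "c = d"
      proof (rule ccontr)
        assume "c \<noteq> d"
        then have "\<not> p dvd c - d" using dvd_diff_I cd by blast
        moreover have "scale3 (c - d) v \<in> line (0, 0, 0)"
        proof (cases v)
          case (fields x y z)
          show ?thesis
            using * unfolding fields scale3.simps zero_line red_eq_iff by (simp add: algebra_simps)
        qed
        ultimately have "v \<in> line (0, 0, 0)"
          using submod_unscale submod_line by blast
        then show False using normalized_nonzero assms by blast
      qed
    qed simp
  next
    fix c assume "c \<in> I"
    have "red (red (scale3 c v)) = red (scale3 c v)" by simp
    then show "red (scale3 c v) \<in> line v \<inter> reps"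
      using red_in_box unfolding line_def by blast
  next
    fix w assume w: "w \<in> line v \<inter> reps"
    then obtain c where c: "red w = red (scale3 c v)" by (auto simp: line_def)
    have "red (scale3 (c mod p) v) = red (scale3 c v)"
      by (cases v) (simp add: mod_mult_left_eq)
    then show "\<exists>c\<in>I. w = red (scale3 c v)"
      using c w red_box p_pos by (intro bexI[of _ "c mod p"]) auto
  qed
  then show ?thesis
    by (simp add: size_mod_def flip: bij_betw_same_card)
qed

section \<open>Submodules of order 1, p and p^3\<close>

lemma size_box: "size_mod UNIV = nat p ^ 3"
  by (simp add: size_mod_def card_cartesian_product power3_eq_cube)

lemma submod_UNIV: "submod UNIV"
  by (simp add: submod_def)

lemma size_zero_line: "size_mod (line (0, 0, 0)) = 1"
proof -
  have "line (0, 0, 0) \<inter> reps = {(0, 0, 0)}"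
    using p_pos dvd_diff_I[of _ 0] by (auto simp: zero_line)
  then show ?thesis by (simp add: size_mod_def)
qed

lemma zero_line_subset: "submod T \<Longrightarrow> line (0, 0, 0) \<subseteq> T"
  by (simp add: line_subset submod_zero)

lemma size_one_iff:
  assumes "submod T"
  shows "size_mod T = 1 \<longleftrightarrow> T = line (0, 0, 0)"
proof
  assume "size_mod T = 1"
  then have "line (0, 0, 0) = T"
    by (intro submod_eqI submod_line assms zero_line_subset) (simp add: size_zero_line)
  then show "T = line (0, 0, 0)" ..
qed (simp only: size_zero_line)

lemma size_full_iff:
  assumes "submod T"
  shows "size_mod T = nat p ^ 3 \<longleftrightarrow> T = UNIV"
proof
  assume "size_mod T = nat p ^ 3"
  then show "T = UNIV"
    by (intro submod_eqI submod_UNIV assms) (simp_all add: size_box)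
qed (simp only: size_box)

lemma normalized_mem_of_size:
  assumes "submod T" "1 < size_mod T"
  obtains v where "v \<in> T" "v \<in> normalized"
proof -
  have "T \<noteq> line (0, 0, 0)"
    using assms(2) size_zero_line by auto
  then have "\<not> T \<subseteq> line (0, 0, 0)"
    using zero_line_subset[OF assms(1)] by blast
  then show ?thesis using normalized_mem[OF assms(1)] that by blast
qed

text \<open>A submodule of order p contains the line through any of its nonzero vectors, and that
  line already has p elements.\<close>

lemma size_p_iff:
  assumes "submod T"
  shows "size_mod T = nat p \<longleftrightarrow> T \<in> line ` normalized"
proof
  assume T: "size_mod T = nat p"
  then have "1 < size_mod T" using p_gt_one by simp
  then obtain v where v: "v \<in> T" "v \<in> normalized" using normalized_mem_of_size assms by blast
  then have "line v = T"
    using submod_eqI[OF submod_line assms line_subset[OF assms v(1)]] T size_line by simp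
  then show "T \<in> line ` normalized" using v by blast
qed (auto simp: size_line)

lemma inj_line: "inj_on line normalized"
proof (rule inj_onI)
  fix v w assume v: "v \<in> normalized" and w: "w \<in> normalized" and "line v = line w"
  then have "w \<in> line v" using line_self by simp
  then obtain c where c: "red w = red (scale3 c v)" by (auto simp: line_def)
  have "red w = w" using w normalized_box red_box by blast
  have not1: "\<not> p dvd 1" "\<not> p dvd -1" using p_gt_one zdvd_not_zless[of 1 p] by auto
  obtain a b d x y z where vw: "v = (a, b, d)" "w = (x, y, z)" by (metis prod.exhaust)
  have dvd: "p dvd x - c * a" "p dvd y - c * b" "p dvd z - c * d"
    using c unfolding vw scale3.simps red_eq_iff by blast+
  have c0: "\<not> p dvd c"
  proof
    assume "p dvd c"
    then have "p dvd x" "p dvd y" "p dvd z"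
      using dvd by (simp_all add: dvd_diff_left_iff)
    then show False
      using normalized_nonzero[OF w] by (simp add: vw zero_line)
  qed
  \<comment> \<open>Since c is a unit modulo p, the leading ones of \<open>v\<close> and
    \<open>w\<close> stand in the same position; comparing them gives c = 1 modulo p.\<close>
  have "p dvd 1 - c"
    using v w dvd not1 c0 unfolding vw normalized_def by auto
  then have "p dvd c - 1"
    by (simp add: dvd_diff_commute)
  then have "p dvd (c - 1) * t" for t by simp
  then have "p dvd (x - c * a) + (c - 1) * a" "p dvd (y - c * b) + (c - 1) * b"
    "p dvd (z - c * d) + (c - 1) * d"
    using dvd by (simp_all only: dvd_add)
  then have "p dvd x - a" "p dvd y - b" "p dvd z - d" by (simp_all add: algebra_simps)
  moreover have "v \<in> reps" "w \<in> reps" using v w normalized_box by blast+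
  ultimately show "v = w" using dvd_diff_I vw by (metis SigmaE2)
qed

lemma card_normalized: "card normalized = 1 + nat p + nat p ^ 2"
proof -
  have "card ({1} \<times> I \<times> I) = nat p ^ 2" "card ({0::int} \<times> {1::int} \<times> I) = nat p"
    by (simp_all add: card_cartesian_product power2_eq_square)
  moreover have "card normalized =
      card ({1} \<times> I \<times> I) + card ({0::int} \<times> {1::int} \<times> I) + card {(0::int, 0::int, 1::int)}"
    unfolding normalized_def
    by (subst card_Un_disjoint, simp, simp, force, subst card_Un_disjoint) auto
  ultimately show ?thesis by simp
qed

end

section \<open>Planes and the bracket of sl2\<close>

text \<open>In coordinates e, f, h the bracket has e-entry twice the second entry of the cross
  product, f-entry twice the first, and h-entry the third; \<open>of_coords_bracket\<close> checks
  this against \<open>sl2\<close>.\<close>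

fun sl2_bracket3 :: "vec3 \<Rightarrow> vec3 \<Rightarrow> vec3" where
  "sl2_bracket3 u v = (case cross u v of (a, b, c) \<Rightarrow> (2 * b, 2 * a, c))"

context prime_modulus
begin

definition bracket_closed3 :: "vec3 set \<Rightarrow> bool" where
  "bracket_closed3 T \<longleftrightarrow> (\<forall>u\<in>T. \<forall>v\<in>T. sl2_bracket3 u v \<in> T)"

section \<open>Planes as orthogonal complements of normalized vectors\<close>

lemma mem_line_iff:
  "(x, y, z) \<in> line (a, b, c) \<longleftrightarrow> (\<exists>k. p dvd x - k * a \<and> p dvd y - k * b \<and> p dvd z - k * c)"
  by (simp only: line_def mem_Collect_eq scale3.simps red_eq_iff)

lemma dvd_box_iff: "x \<in> I \<Longrightarrow> p dvd x - t \<longleftrightarrow> x = t mod p"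
  using mod_eq_dvd_iff[of x p t] by auto

text \<open>The leading entry of the normal is 1, so the equation of the plane can be solved for
  that coordinate while the other two range freely over the box.\<close>

lemma size_perp:
  assumes "n \<in> normalized"
  shows "size_mod (perp n) = nat p ^ 2"
proof -
  have card_II: "card (I \<times> I) = nat p ^ 2"
    by (simp add: card_cartesian_product power2_eq_square)
  have mod_in_I: "t mod p \<in> I" for t
    using p_pos by simp
  have "\<exists>f. bij_betw f (I \<times> I) (perp n \<inter> reps)"
  proof -
    obtain a b c where n: "n = (a, b, c)" by (metis prod.exhaust)
    consider "a = 1" | "a = 0" "b = 1" | "a = 0" "b = 0" "c = 1"
      using assms by (auto simp: n normalized_def)
    then show ?thesis
    proof cases
      case 1
      have "perp n \<inter> reps = (\<lambda>(y, z). ((- b * y - c * z) mod p, y, z)) ` (I \<times> I)"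
      proof (intro equalityI subsetI)
        fix v assume "v \<in> perp n \<inter> reps"
        then obtain x y z where v: "v = (x, y, z)" "x \<in> I" "y \<in> I" "z \<in> I" "p dvd x + b * y + c * z"
          using 1 by (auto simp: n perp_def)
        then have "x = (- b * y - c * z) mod p"
          using dvd_box_iff[of x "- b * y - c * z"] by (simp add: algebra_simps)
        then show "v \<in> (\<lambda>(y, z). ((- b * y - c * z) mod p, y, z)) ` (I \<times> I)"
          using v by (intro image_eqI[of _ _ "(y, z)"]) simp_all
      next
        fix v assume "v \<in> (\<lambda>(y, z). ((- b * y - c * z) mod p, y, z)) ` (I \<times> I)"
        then obtain y z where v: "v = ((- b * y - c * z) mod p, y, z)" "y \<in> I" "z \<in> I"
          by (elim imageE) auto
        have "p dvd (- b * y - c * z) mod p - (- b * y - c * z)"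
          using dvd_box_iff mod_in_I by blast
        then show "v \<in> perp n \<inter> reps"
          using v 1 mod_in_I by (simp add: n perp_def algebra_simps)
      qed
      then show ?thesis
        by (intro exI[of _ "\<lambda>(y, z). ((- b * y - c * z) mod p, y, z)"])
          (auto simp: bij_betw_def inj_on_def)
    next
      case 2
      have "perp n \<inter> reps = (\<lambda>(x, z). (x, (- c * z) mod p, z)) ` (I \<times> I)"
      proof (intro equalityI subsetI)
        fix v assume "v \<in> perp n \<inter> reps"
        then obtain x y z where v: "v = (x, y, z)" "x \<in> I" "y \<in> I" "z \<in> I" "p dvd y + c * z"
          using 2 by (auto simp: n perp_def)
        then have "y = (- c * z) mod p"
          using dvd_box_iff[of y "- c * z"] by (simp add: algebra_simps)
        then show "v \<in> (\<lambda>(x, z). (x, (- c * z) mod p, z)) ` (I \<times> I)"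
          using v by (intro image_eqI[of _ _ "(x, z)"]) simp_all
      next
        fix v assume "v \<in> (\<lambda>(x, z). (x, (- c * z) mod p, z)) ` (I \<times> I)"
        then obtain x z where v: "v = (x, (- c * z) mod p, z)" "x \<in> I" "z \<in> I"
          by (elim imageE) auto
        have "p dvd (- c * z) mod p - (- c * z)"
          using dvd_box_iff mod_in_I by blast
        then show "v \<in> perp n \<inter> reps"
          using v 2 mod_in_I by (simp add: n perp_def algebra_simps)
      qed
      then show ?thesis
        by (intro exI[of _ "\<lambda>(x, z). (x, (- c * z) mod p, z)"])
          (auto simp: bij_betw_def inj_on_def)
    next
      case 3
      have "p dvd z \<longleftrightarrow> z = 0" if "z \<in> I" for z
        using that dvd_box_iff[of z 0] by simp
      then have "perp n \<inter> reps = (\<lambda>(x, y). (x, y, 0)) ` (I \<times> I)"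
        using 3 p_pos by (auto simp: n perp_def image_iff)
      then show ?thesis
        by (intro exI[of _ "\<lambda>(x, y). (x, y, 0)"]) (auto simp: bij_betw_def inj_on_def)
    qed
  qed
  then show ?thesis
    unfolding size_mod_def using card_II by (metis bij_betw_same_card)
qed

text \<open>Vectors with vanishing cross product are parallel. The scalar is the entry of
  \<open>w\<close> at the position where \<open>v\<close> has its leading 1.\<close>

lemma mem_line_of_cross:
  assumes "v \<in> normalized" "cross v w \<in> line (0, 0, 0)"
  shows "w \<in> line v"
proof -
  obtain a b c x y z where vw: "v = (a, b, c)" "w = (x, y, z)" by (metis prod.exhaust)
  have d: "p dvd b * z - c * y" "p dvd c * x - a * z" "p dvd a * y - b * x"
    using assms(2) by (simp_all add: vw zero_line)
  consider "a = 1" | "a = 0" "b = 1" | "a = 0" "b = 0" "c = 1"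
    using assms(1) by (auto simp: vw normalized_def)
  then show ?thesis
  proof cases
    case 1
    then show ?thesis
      unfolding vw mem_line_iff using d
      by (intro exI[of _ x]) (simp add: mult.commute dvd_diff_commute)
  next
    case 2
    then show ?thesis
      unfolding vw mem_line_iff using d
      by (intro exI[of _ y]) (simp add: mult.commute dvd_diff_commute)
  next
    case 3
    then show ?thesis
      unfolding vw mem_line_iff using d by (intro exI[of _ z]) simp
  qed
qed

lemma dot_line:
  assumes u: "u \<in> line v" and d: "p dvd dot3 v w"
  shows "p dvd dot3 u w"
proof -
  obtain a b c x y z r s t where vw: "v = (a, b, c)" "u = (x, y, z)" "w = (r, s, t)"
    by (metis prod.exhaust)
  obtain k where "p dvd x - k * a" "p dvd y - k * b" "p dvd z - k * c"
    using u unfolding vw mem_line_iff by blast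
  then have "p dvd (x - k * a) * r + (y - k * b) * s + (z - k * c) * t + k * (a * r + b * s + c * t)"
    using d by (intro dvd_add) (simp_all add: vw)
  then show ?thesis by (simp add: vw algebra_simps)
qed

lemma dot_cross: "dot3 (cross u v) u = 0" "dot3 (cross u v) v = 0"
  by (cases u; cases v; simp add: algebra_simps)+

text \<open>Independence makes the p^2 combinations of \<open>v\<close> and \<open>w\<close> with
  residue coefficients pairwise incongruent.\<close>

lemma size_span:
  assumes S: "submod S" "v \<in> S" "w \<in> S" and v: "v \<in> normalized" and w: "w \<notin> line v"
  shows "nat p ^ 2 \<le> size_mod S"
proof -
  let ?f = "\<lambda>(a, b). red (scale3 a v + scale3 b w)"
  have "inj_on ?f (I \<times> I)"
  proof (rule inj_onI, clarify)
    fix a b a' b' assume I: "a \<in> I" "b \<in> I" "a' \<in> I" "b' \<in> I"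
      and eq: "red (scale3 a v + scale3 b w) = red (scale3 a' v + scale3 b' w)"
    obtain x y z r s t where vw: "v = (x, y, z)" "w = (r, s, t)" by (metis prod.exhaust)
    have d: "p dvd (a * x + b * r) - (a' * x + b' * r)" "p dvd (a * y + b * s) - (a' * y + b' * s)"
      "p dvd (a * z + b * t) - (a' * z + b' * t)"
      using eq unfolding vw scale3.simps add_Pair red_eq_iff by blast+
    \<comment> \<open>Were b - b' a unit modulo p, \<open>w\<close> itself would lie on the line of
      \<open>v\<close>.\<close>
    have "scale3 (b - b') w \<in> line v"
      unfolding vw scale3.simps mem_line_iff
      using d by (intro exI[of _ "a' - a"]) (simp add: algebra_simps)
    then have "p dvd b - b'"
      using submod_unscale submod_line w by blast
    then have b: "b = b'" using dvd_diff_I I by blast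
    have "scale3 (a - a') v \<in> line (0, 0, 0)"
      unfolding vw scale3.simps zero_line using d by (simp add: b algebra_simps)
    then have "p dvd a - a'"
      using submod_unscale submod_line normalized_nonzero[OF v] by blast
    then show "a = a' \<and> b = b'" using dvd_diff_I I b by blast
  qed
  moreover have "red (scale3 a v + scale3 b w) \<in> S \<inter> reps" for a b
  proof -
    have "scale3 a v + scale3 b w \<in> S" using S unfolding submod_def by blast
    then show ?thesis using S(1) submod_red_iff red_in_box by blast
  qed
  then have "?f ` (I \<times> I) \<subseteq> S \<inter> reps"
    by force
  ultimately have "card (I \<times> I) \<le> size_mod S"
    unfolding size_mod_def using card_inj_on_le finite_size by blast
  then show ?thesis by (simp add: card_cartesian_product power2_eq_square)
qed

lemma submod_Int: "\<lbrakk>submod S; submod T\<rbrakk> \<Longrightarrow> submod (S \<inter> T)"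
  by (simp add: submod_def)

text \<open>Pick independent \<open>v\<close> and \<open>w\<close> in \<open>T\<close> and normalize
  their cross product to a normal \<open>m\<close>. Then \<open>T \<inter> perp m\<close> contains
  both vectors, so it has at least p^2 elements and coincides with each of the two planes.\<close>

lemma size_p2_iff:
  assumes "submod T"
  shows "size_mod T = nat p ^ 2 \<longleftrightarrow> T \<in> perp ` normalized"
proof
  assume T: "size_mod T = nat p ^ 2"
  have "nat p < nat p ^ 2"
    using p_gt_one by (simp add: power2_eq_square)
  then have "1 < size_mod T" "nat p < size_mod T"
    using T p_gt_one by simp_all
  then obtain v where v: "v \<in> T" "v \<in> normalized" using normalized_mem_of_size assms by blast
  have "T \<noteq> line v"
    using size_line[OF v(2)] \<open>nat p < size_mod T\<close> by auto
  then obtain w where w: "w \<in> T" "w \<notin> line v"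
    using line_subset[OF assms v(1)] by blast
  have "cross v w \<notin> line (0, 0, 0)"
    using mem_line_of_cross v w by blast
  then obtain m where m: "m \<in> line (cross v w)" "m \<in> normalized"
    using normalized_mem[OF submod_line] line_self by blast
  have vw: "v \<in> perp m" "w \<in> perp m"
    using dot_line[OF m(1)] dot_cross by (simp_all add: perp_def)
  let ?S = "T \<inter> perp m"
  have S: "submod ?S" using submod_Int assms submod_perp by blast
  have "nat p ^ 2 \<le> size_mod ?S"
    using size_span[OF S _ _ v(2) w(2)] v w vw by blast
  then have "?S = T" "?S = perp m"
    using submod_eqI[OF S assms Int_lower1] submod_eqI[OF S submod_perp Int_lower2]
      T size_perp[OF m(2)] by simp_all
  then have "T = perp m" by (rule subst)
  then show "T \<in> perp ` normalized" using m(2) by blast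
qed (auto simp: size_perp)

lemma inj_perp: "inj_on perp normalized"
proof (rule inj_onI)
  fix m n assume m: "m \<in> normalized" and n: "n \<in> normalized" and eq: "perp m = perp n"
  obtain a b c x y z where mn: "m = (a, b, c)" "n = (x, y, z)" by (metis prod.exhaust)
  \<comment> \<open>These vectors are orthogonal to \<open>m\<close>, and their dot products with
    \<open>n\<close> are the entries of \<open>cross m n\<close>.\<close>
  have "(0, - c, b) \<in> perp n" "(c, 0, - a) \<in> perp n" "(- b, a, 0) \<in> perp n"
    unfolding eq[symmetric] by (simp_all add: perp_def mn)
  then have "cross m n \<in> line (0, 0, 0)"
    by (simp add: perp_def mn zero_line algebra_simps)
  then have "n \<in> line m" using mem_line_of_cross m by blast
  then have "line n = line m"
    using submod_eqI[OF submod_line submod_line line_subset[OF submod_line]] size_line m n by simp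
  then show "m = n" using inj_line m n by (simp add: inj_on_eq_iff)
qed

section \<open>Closure of lines and planes under the bracket, and the count of closed planes\<close>

lemma cross_line:
  assumes "u \<in> line v" "w \<in> line v"
  shows "cross u w \<in> line (0, 0, 0)"
proof -
  have *: "p dvd y * z' - z * y'" if "p dvd y - k * b" "p dvd z - k * c" "p dvd y' - l * b" "p dvd z' - l * c"
    for y z y' z' k l b c
  proof -
    \<comment> \<open>On expansion everything cancels except y z' - z y'.\<close>
    have "p dvd (y - k * b) * z' - (z - k * c) * y' + (k * b) * (z' - l * c) - (k * c) * (y' - l * b)"
      using that by (intro dvd_add dvd_diff) simp_all
    then show ?thesis by (simp add: algebra_simps)
  qed
  obtain a b c x y z x' y' z' where uvw: "v = (a, b, c)" "u = (x, y, z)" "w = (x', y', z')"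
    by (metis prod.exhaust)
  obtain k l where "p dvd x - k * a" "p dvd y - k * b" "p dvd z - k * c"
    "p dvd x' - l * a" "p dvd y' - l * b" "p dvd z' - l * c"
    using assms unfolding uvw mem_line_iff by blast
  then show ?thesis
    unfolding uvw cross.simps zero_line by (intro conjI; elim *)
qed

lemma bracket_closed_line: "bracket_closed3 (line v)"
  unfolding bracket_closed3_def
proof (intro ballI)
  fix u w assume "u \<in> line v" "w \<in> line v"
  then have "cross u w \<in> line (0, 0, 0)" by (rule cross_line)
  then have "sl2_bracket3 u w \<in> line (0, 0, 0)"
    by (cases "cross u w") (simp add: zero_line)
  then show "sl2_bracket3 u w \<in> line v"
    using zero_line_subset submod_line by blast
qed

text \<open>Turning the cross product n = (a, b, c) into a bracket gives (2b, 2a, c), whose dot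
  product with n is 4ab + c^2. Since cross products of vectors in the plane are multiples of n
  modulo p, this one value decides closure.\<close>

lemma bracket_closed_perp_iff:
  assumes "(a, b, c) \<in> normalized"
  shows "bracket_closed3 (perp (a, b, c)) \<longleftrightarrow> p dvd 4 * a * b + c ^ 2"
proof
  assume closed: "bracket_closed3 (perp (a, b, c))"
  \<comment> \<open>The normal is itself a cross product of two vectors, which then lie in its
    plane; they are read off from the position of the leading 1.\<close>
  have "\<exists>v w. cross v w = (a, b, c)"
  proof -
    consider "a = 1" | "a = 0" "b = 1" | "a = 0" "b = 0" "c = 1"
      using assms by (auto simp: normalized_def)
    then show ?thesis
    proof cases
      case 1
      then have "cross (- b, 1, 0) (- c, 0, 1) = (a, b, c)" by simp
      then show ?thesis by blast
    next
      case 2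
      then have "cross (0, - c, 1) (1, 0, 0) = (a, b, c)" by simp
      then show ?thesis by blast
    next
      case 3
      then have "cross (1, 0, 0) (0, 1, 0) = (a, b, c)" by simp
      then show ?thesis by blast
    qed
  qed
  then obtain v w where vw: "cross v w = (a, b, c)" by blast
  then have "v \<in> perp (a, b, c)" "w \<in> perp (a, b, c)"
    using dot_cross[where u = v and v = w] by (simp_all add: perp_def del: dot3.simps)
  then have "sl2_bracket3 v w \<in> perp (a, b, c)"
    using closed by (simp add: bracket_closed3_def del: sl2_bracket3.simps)
  then show "p dvd 4 * a * b + c ^ 2"
    by (simp add: vw perp_def power2_eq_square algebra_simps)
next
  assume d: "p dvd 4 * a * b + c ^ 2"
  show "bracket_closed3 (perp (a, b, c))"
    unfolding bracket_closed3_def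
  proof (intro ballI)
    fix u v assume u: "u \<in> perp (a, b, c)" and v: "v \<in> perp (a, b, c)"
    obtain x y z x' y' z' where uv: "u = (x, y, z)" "v = (x', y', z')" by (metis prod.exhaust)
    let ?U = "a * x + b * y + c * z" and ?V = "a * x' + b * y' + c * z'"
    have "p dvd ?U" "p dvd ?V" using u v by (simp_all add: uv perp_def)
    \<comment> \<open>These are the entries of n \<times> (u \<times> v) = (n . v) u - (n . u) v,
      which vanishes modulo p for \<open>u\<close> and \<open>v\<close> in the plane.\<close>
    then have "p dvd x * ?V - x' * ?U" "p dvd y * ?V - y' * ?U" "p dvd z * ?V - z' * ?U"
      by simp_all
    then have "cross (a, b, c) (cross u v) \<in> line (0, 0, 0)"
      by (simp add: uv zero_line algebra_simps)
    then have "cross u v \<in> line (a, b, c)" using mem_line_of_cross assms by blast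
    moreover obtain r s t where rst: "cross u v = (r, s, t)" by (metis prod.exhaust)
    \<comment> \<open>Swapping and doubling entries can be moved to the other factor: the dot
      product of n with the bracket equals that of the cross product with (2b, 2a, c).\<close>
    ultimately have "p dvd dot3 (r, s, t) (2 * b, 2 * a, c)"
      using dot_line[of "(r, s, t)" "(a, b, c)" "(2 * b, 2 * a, c)"] d
      by (simp add: power2_eq_square algebra_simps)
    then show "sl2_bracket3 u v \<in> perp (a, b, c)"
      by (simp add: rst perp_def algebra_simps)
  qed
qed

text \<open>For p = 2 the term 4b vanishes, which forces c = 0 and leaves b free. For odd p, 4 is
  invertible and c determines b = - c^2 / 4.\<close>

lemma card_conic:
  "card {(b, c). b \<in> I \<and> c \<in> I \<and> p dvd 4 * b + c ^ 2} = nat p"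
proof (cases "p = 2")
  case True
  have "{(b, c). b \<in> I \<and> c \<in> I \<and> p dvd 4 * b + c ^ 2} = I \<times> {0}"
    using True by (auto simp: dvd_add_right_iff)
  then show ?thesis by (simp add: card_cartesian_product)
next
  case False
  have "\<not> p dvd 2"
    using False p_gt_one zdvd_imp_le[of p 2] by auto
  then have "\<not> p dvd 2 * 2"
    using prime_p prime_dvd_mult_iff by blast
  then obtain e where e: "p dvd e * 4 - 1" using inverse_mod_exists[of 4] by auto
  have mod_in_I: "t mod p \<in> I" for t
    using p_pos by simp
  have iff: "p dvd 4 * b + c ^ 2 \<longleftrightarrow> p dvd b - (- e * c ^ 2)" for b c
  proof
    assume "p dvd 4 * b + c ^ 2"
    then have "p dvd e * (4 * b + c ^ 2) - (e * 4 - 1) * b"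
      using e by (intro dvd_diff) simp_all
    then show "p dvd b - (- e * c ^ 2)" by (simp add: algebra_simps)
  next
    assume "p dvd b - (- e * c ^ 2)"
    from dvd_diff[OF dvd_mult[OF this, of 4] dvd_mult2[OF e, of "c ^ 2"]]
    show "p dvd 4 * b + c ^ 2" by (simp add: algebra_simps)
  qed
  have "{(b, c). b \<in> I \<and> c \<in> I \<and> p dvd 4 * b + c ^ 2} = (\<lambda>c. ((- e * c ^ 2) mod p, c)) ` I"
  proof -
    have "p dvd 4 * b + c ^ 2 \<longleftrightarrow> b = (- e * c ^ 2) mod p" if "b \<in> I" for b c
      by (simp only: iff dvd_box_iff[OF that])
    then show ?thesis using mod_in_I by blast
  qed
  then show ?thesis
    by (simp add: card_image inj_on_def)
qed

text \<open>Normals with first entry 1 are counted by \<open>card_conic\<close>. With first entry 0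
  the condition becomes c^2 = 0 modulo p, which admits (0, 1, 0) alone.\<close>

lemma card_closed_planes:
  "card {n \<in> normalized. bracket_closed3 (perp n)} = 1 + nat p"
proof -
  let ?C = "{(b, c). b \<in> I \<and> c \<in> I \<and> p dvd 4 * b + c ^ 2}"
  have zero: "p dvd c ^ 2 \<longleftrightarrow> c = 0" if "c \<in> I" for c
    using dvd_box_iff[OF that, of 0] by (simp add: prime_dvd_power_iff prime_p)
  have not1: "\<not> p dvd 1"
    using p_gt_one by (simp add: zdvd1_eq)
  have "{n \<in> normalized. bracket_closed3 (perp n)} = {(0, 1, 0)} \<union> {1} \<times> ?C"
  proof (rule Set.set_eqI)
    fix n :: vec3
    obtain a b c where n: "n = (a, b, c)" by (metis prod.exhaust)
    have "n \<in> {n \<in> normalized. bracket_closed3 (perp n)} \<longleftrightarrow>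
        (a, b, c) \<in> normalized \<and> p dvd 4 * a * b + c ^ 2"
      using bracket_closed_perp_iff n by blast
    also have "\<dots> \<longleftrightarrow> n \<in> {(0, 1, 0)} \<union> {1} \<times> ?C"
      using zero not1 p_pos by (cases "a = 1"; cases "b = 1") (auto simp: n normalized_def)
    finally show "n \<in> {n \<in> normalized. bracket_closed3 (perp n)} \<longleftrightarrow> n \<in> {(0, 1, 0)} \<union> {1} \<times> ?C" .
  qed
  moreover have "finite ?C"
    by (rule finite_subset[of _ "I \<times> I"]) auto
  ultimately show ?thesis
    using card_conic by (simp add: card_cartesian_product)
qed

text \<open>The index is the dimension, not the codimension.\<close>

definition closed_submods :: "nat \<Rightarrow> vec3 set set" where
  "closed_submods d = {T. submod T \<and> bracket_closed3 T \<and> size_mod T = nat p ^ d}"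

lemma card_closed_submods:
  "card (closed_submods 0) = 1"
  "card (closed_submods 1) = 1 + nat p + nat p ^ 2"
  "card (closed_submods 2) = 1 + nat p"
  "card (closed_submods 3) = 1"
proof -
  have "closed_submods 0 = {line (0, 0, 0)}"
    using size_one_iff submod_line bracket_closed_line by (auto simp: closed_submods_def)
  then show "card (closed_submods 0) = 1" by simp
  have "closed_submods 1 = line ` normalized"
    using size_p_iff submod_line bracket_closed_line by (auto simp: closed_submods_def)
  then show "card (closed_submods 1) = 1 + nat p + nat p ^ 2"
    using inj_line card_normalized by (simp add: card_image)
  have "closed_submods 2 = perp ` {n \<in> normalized. bracket_closed3 (perp n)}"
    using size_p2_iff submod_perp by (auto simp: closed_submods_def)
  moreover have "inj_on perp {n \<in> normalized. bracket_closed3 (perp n)}"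
    using inj_perp by (rule inj_on_subset) auto
  ultimately show "card (closed_submods 2) = 1 + nat p"
    using card_closed_planes by (simp add: card_image)
  have "closed_submods 3 = {UNIV}"
    using size_full_iff submod_UNIV by (auto simp: closed_submods_def bracket_closed3_def)
  then show "card (closed_submods 3) = 1" by simp
qed

end

section \<open>Subalgebras of sl2 modulo a prime\<close>

text \<open>The coordinates are ordered as \<open>e\<close>, \<open>f\<close>, \<open>h\<close>.\<close>

fun of_coords :: "vec3 \<Rightarrow> sl2_gen \<Rightarrow> int" where
  "of_coords (x, y, z) = case_sl2_gen x y z"

lemma sl2_simps:
  "carrier sl2 = UNIV"
  "u \<oplus>\<^bsub>sl2\<^esub> v = (\<lambda>k. u k + v k)"
  "c \<odot>\<^bsub>sl2\<^esub> u = (\<lambda>k. c * u k)"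
  by (simp_all add: sl2_def presented_lie_ring_def)

lemma of_coords_eq_iff: "f = of_coords (x, y, z) \<longleftrightarrow> f gen_e = x \<and> f gen_f = y \<and> f gen_h = z"
proof
  assume "f gen_e = x \<and> f gen_f = y \<and> f gen_h = z"
  then have "f k = of_coords (x, y, z) k" for k by (cases k) simp_all
  then show "f = of_coords (x, y, z)" by blast
qed simp

lemma of_coords_surj: "\<exists>v. f = of_coords v"
  by (rule exI[of _ "(f gen_e, f gen_f, f gen_h)"]) (simp only: of_coords_eq_iff)

lemma of_coords_add: "of_coords (u + v) = of_coords u \<oplus>\<^bsub>sl2\<^esub> of_coords v"
  by (cases u; cases v) (rule sym, simp only: of_coords_eq_iff add_Pair, simp add: sl2_simps)

lemma of_coords_scale: "of_coords (scale3 c v) = c \<odot>\<^bsub>sl2\<^esub> of_coords v"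
  by (cases v) (rule sym, simp only: of_coords_eq_iff scale3.simps, simp add: sl2_simps)

lemma of_coords_bracket:
  "of_coords (sl2_bracket3 u v) = lie_bracket sl2 (of_coords u) (of_coords v)"
  by (cases u; cases v)
    (rule sym, simp only: of_coords_eq_iff sl2_bracket3.simps cross.simps prod.case,
      simp add: sl2_def presented_lie_ring_def basis_vec_def algebra_simps)

section \<open>Subspaces of the tensor product as images of submodules of \<int>^3\<close>

context prime_modulus
begin

interpretation R: lie_ring_mod sl2 p
  by (rule lie_ring_mod.intro[OF sl2_lie_ring]) (simp add: lie_ring_mod_axioms_def p_gt_one)

abbreviation K where "K \<equiv> residue_ring p"

abbreviation LK where "LK \<equiv> extend_scalars sl2 K"

interpretation LK: vectorspace K LK
  by (rule R.vectorspace_LK[OF prime_p])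

definition reduce3 where "reduce3 v = R.reduce (of_coords v)"

lemma carrier_LK_eq_reduce3: "carrier LK = range reduce3"
proof -
  have "range of_coords = UNIV" using of_coords_surj by blast
  then show ?thesis
    by (simp add: R.carrier_LK_eq_reduce sl2_simps reduce3_def[abs_def] image_image[symmetric])
qed

lemma reduce3_eq_iff: "reduce3 u = reduce3 v \<longleftrightarrow> red u = red v"
proof -
  obtain x y z x' y' z' where uv: "u = (x, y, z)" "v = (x', y', z')" by (metis prod.exhaust)
  have "reduce3 u = reduce3 v \<longleftrightarrow> (\<exists>w. of_coords u = of_coords v \<oplus>\<^bsub>sl2\<^esub> p \<odot>\<^bsub>sl2\<^esub> of_coords w)"
    using of_coords_surj by (simp add: reduce3_def R.reduce_eq_iff sl2_simps(1)) metis
  also have "\<dots> \<longleftrightarrow> (\<exists>w. u = v + scale3 p w)"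
    by (simp only: flip: of_coords_add of_coords_scale)
      (metis of_coords_eq_iff prod.exhaust)
  also have "\<dots> \<longleftrightarrow> p dvd x - x' \<and> p dvd y - y' \<and> p dvd z - z'"
  proof
    assume "p dvd x - x' \<and> p dvd y - y' \<and> p dvd z - z'"
    then obtain a b c where "x - x' = p * a" "y - y' = p * b" "z - z' = p * c"
      by (auto elim!: dvdE)
    then have "u = v + scale3 p (a, b, c)" by (simp add: uv algebra_simps)
    then show "\<exists>w. u = v + scale3 p w" by blast
  qed (auto simp: uv)
  finally show ?thesis by (simp only: uv red_eq_iff)
qed

lemma reduce3_add: "reduce3 (u + v) = reduce3 u \<oplus>\<^bsub>LK\<^esub> reduce3 v"
  by (simp add: reduce3_def of_coords_add R.reduce_add sl2_simps(1))

lemma reduce3_scale: "reduce3 (scale3 c v) = (c mod p) \<odot>\<^bsub>LK\<^esub> reduce3 v"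
proof -
  have "red (scale3 c v) = red (scale3 (c mod p) v)"
    by (cases v) (simp add: mod_mult_left_eq)
  then have "reduce3 (scale3 c v) = reduce3 (scale3 (c mod p) v)"
    by (simp only: reduce3_eq_iff)
  also have "\<dots> = (c mod p) \<odot>\<^bsub>LK\<^esub> reduce3 v"
    by (simp add: reduce3_def of_coords_scale R.reduce_smult sl2_simps(1) R.K.mod_in_carrier)
  finally show ?thesis .
qed

lemma reduce3_zero: "reduce3 (scale3 p v) = \<zero>\<^bsub>LK\<^esub>"
  by (simp add: reduce3_def of_coords_scale R.reduce_p_smult sl2_simps(1))

lemma reduce3_bracket: "reduce3 (sl2_bracket3 u v) = lie_bracket LK (reduce3 u) (reduce3 v)"
  by (simp only: reduce3_def of_coords_bracket R.reduce_bracket sl2_simps(1) UNIV_I)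

text \<open>A \<open>submod\<close> is a union of fibres of \<open>reduce3\<close>, so it can be
  recovered from its image; this makes the correspondence with subalgebras injective.\<close>

lemma vimage_reduce3_image: "submod T \<Longrightarrow> reduce3 -` reduce3 ` T = T"
  using submod_red_eq reduce3_eq_iff by blast

lemma card_reduce3_image:
  assumes "submod T"
  shows "card (reduce3 ` T) = size_mod T"
proof -
  have "inj_on reduce3 (T \<inter> reps)"
    by (rule inj_onI) (metis IntD2 reduce3_eq_iff red_box)
  moreover have "reduce3 ` (T \<inter> reps) = reduce3 ` T"
  proof
    show "reduce3 ` T \<subseteq> reduce3 ` (T \<inter> reps)"
    proof
      fix x assume "x \<in> reduce3 ` T"
      then obtain v where v: "v \<in> T" "x = reduce3 v" by blast
      then have "x = reduce3 (red v)" by (simp add: reduce3_eq_iff)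
      then show "x \<in> reduce3 ` (T \<inter> reps)"
        using v assms submod_red_iff red_in_box by blast
    qed
  qed blast
  ultimately show ?thesis
    unfolding size_mod_def using card_image by metis
qed

lemma lie_subalgebra_iff:
  "lie_subalgebra K H LK \<longleftrightarrow> (\<exists>T. submod T \<and> bracket_closed3 T \<and> H = reduce3 ` T)"
proof
  assume "lie_subalgebra K H LK"
  then have sub: "submodule K H LK" and br: "\<And>x y. \<lbrakk>x \<in> H; y \<in> H\<rbrakk> \<Longrightarrow> lie_bracket LK x y \<in> H"
    by (auto simp: lie_subalgebra_def subspace_def)
  \<comment> \<open>The full preimage contains p\<int>^3, because \<open>reduce3\<close> sends it to
    zero.\<close>
  let ?T = "reduce3 -` H"
  have "submod ?T"
    using submodule.m_closed[OF sub] submodule.smult_closed[OF sub] submodule.zero_closed[OF sub]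
      R.K.mod_in_carrier
    unfolding submod_def vimage_eq reduce3_add reduce3_zero unfolding reduce3_scale
    by blast
  moreover have "bracket_closed3 ?T"
    using br unfolding bracket_closed3_def vimage_eq reduce3_bracket by blast
  moreover have "H = reduce3 ` ?T"
    using submodule.subset[OF sub] by (auto simp: carrier_LK_eq_reduce3)
  ultimately show "\<exists>T. submod T \<and> bracket_closed3 T \<and> H = reduce3 ` T" by blast
next
  assume "\<exists>T. submod T \<and> bracket_closed3 T \<and> H = reduce3 ` T"
  then obtain T where T: "submod T" "bracket_closed3 T" and H: "H = reduce3 ` T" by blast
  have "submodule K H LK"
  proof (rule submodule.intro)
    show "module K LK" by (rule LK.module_axioms)
    show "H \<subseteq> carrier LK" by (auto simp: H carrier_LK_eq_reduce3)
    show "x \<oplus>\<^bsub>LK\<^esub> y \<in> H" if "x \<in> H" "y \<in> H" for x y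
    proof -
      obtain u v where uv: "u \<in> T" "x = reduce3 u" "v \<in> T" "y = reduce3 v"
        using \<open>x \<in> H\<close> \<open>y \<in> H\<close> H by blast
      then have "reduce3 (u + v) \<in> H" using T(1) unfolding H submod_def by blast
      then show ?thesis by (simp only: reduce3_add uv)
    qed
    show "\<zero>\<^bsub>LK\<^esub> \<in> H"
    proof -
      have "reduce3 (scale3 p (0, 0, 0)) \<in> H" using T(1) unfolding submod_def H by blast
      then show ?thesis by (simp only: reduce3_zero)
    qed
    show "c \<odot>\<^bsub>LK\<^esub> x \<in> H" if "c \<in> carrier K" "x \<in> H" for c x
    proof -
      obtain v where v: "v \<in> T" "x = reduce3 v" using \<open>x \<in> H\<close> H by blast
      \<comment> \<open>Elements of \<open>K\<close> are their own residues, so a scalar of the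
        field acts as an integer scalar.\<close>
      have "c mod p = c" using \<open>c \<in> carrier K\<close> by (simp add: R.K.res_carrier_eq)
      then have "c \<odot>\<^bsub>LK\<^esub> x = reduce3 (scale3 c v)" by (simp only: reduce3_scale v)
      moreover have "reduce3 (scale3 c v) \<in> H" using v T(1) unfolding H submod_def by blast
      ultimately show ?thesis by simp
    qed
  qed
  moreover have "lie_bracket LK x y \<in> H" if "x \<in> H" "y \<in> H" for x y
  proof -
    obtain u v where uv: "u \<in> T" "x = reduce3 u" "v \<in> T" "y = reduce3 v"
      using \<open>x \<in> H\<close> \<open>y \<in> H\<close> H by blast
    then have "reduce3 (sl2_bracket3 u v) \<in> H" using T(2) unfolding H bracket_closed3_def by blast
    then show ?thesis by (simp only: reduce3_bracket uv)
  qed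
  ultimately show "lie_subalgebra K H LK"
    by (simp add: lie_subalgebra_def subspace_def LK.vectorspace_axioms)
qed

section \<open>Dimension, codimension and the zeta function\<close>

lemma card_K: "card (carrier K) = nat p"
  by (simp add: R.K.res_carrier_eq)

lemma size_mod_eq_power_dim:
  assumes "submod T" "subspace K (reduce3 ` T) LK"
  shows "size_mod T = nat p ^ vectorspace.dim K (LK\<lparr>carrier := reduce3 ` T\<rparr>)"
proof -
  have vs: "vectorspace K (LK\<lparr>carrier := reduce3 ` T\<rparr>)"
    by (rule LK.subspace_is_vs[OF assms(2)])
  have "(0, 0, 0) \<in> T \<inter> reps"
    using submod_zero[OF assms(1)] p_pos by simp
  then have "T \<inter> reps \<noteq> {}"
    by blast
  then have "card (reduce3 ` T) \<noteq> 0"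
    unfolding card_reduce3_image[OF assms(1)] size_mod_def by simp
  \<comment> \<open>The cardinality of an infinite set is 0 by convention, so a nonzero cardinality
    yields finiteness.\<close>
  then have "finite (reduce3 ` T)"
    by (rule contrapos_np) (rule card.infinite)
  then show ?thesis
    using vectorspace.card_carrier_eq_power_dim[OF vs] card_reduce3_image[OF assms(1)]
    by (simp add: card_K)
qed

text \<open>The dimension is read off from the cardinality p^3, as powers of p > 1 determine their
  exponents.\<close>

lemma dim_LK: "vectorspace.dim K LK = 3"
proof -
  have "card (carrier LK) = nat p ^ 3"
    by (simp add: carrier_LK_eq_reduce3 card_reduce3_image submod_UNIV size_box)
  moreover from this have "finite (carrier LK)"
    using p_pos by (intro card_ge_0_finite) simp
  ultimately have "nat p ^ vectorspace.dim K LK = nat p ^ 3"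
    using LK.card_carrier_eq_power_dim by (simp add: card_K)
  then show ?thesis
    using p_gt_one by (subst (asm) power_inject_exp) simp_all
qed

lemma lie_subalgebras_of_codim_eq:
  assumes "i \<le> 3"
  shows "lie_subalgebras_of_codim K LK i = (`) reduce3 ` closed_submods (3 - i)"
proof -
  have dim: "vectorspace.dim K (LK\<lparr>carrier := reduce3 ` T\<rparr>) + i = 3 \<longleftrightarrow> size_mod T = nat p ^ (3 - i)"
    if "submod T" "lie_subalgebra K (reduce3 ` T) LK" for T
  proof -
    have "size_mod T = nat p ^ (3 - i) \<longleftrightarrow> vectorspace.dim K (LK\<lparr>carrier := reduce3 ` T\<rparr>) = 3 - i"
      using size_mod_eq_power_dim that p_gt_one by (simp add: lie_subalgebra_def power_inject_exp)
    \<comment> \<open>The bound on \<open>i\<close> makes the truncated subtraction exact.\<close>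
    then show ?thesis using assms by linarith
  qed
  show ?thesis
  proof (intro equalityI subsetI)
    fix H assume "H \<in> lie_subalgebras_of_codim K LK i"
    then have H: "lie_subalgebra K H LK" "vectorspace.dim K (LK\<lparr>carrier := H\<rparr>) + i = 3"
      by (simp_all add: lie_subalgebras_of_codim_def dim_LK)
    then obtain T where T: "submod T" "bracket_closed3 T" "H = reduce3 ` T"
      using lie_subalgebra_iff by blast
    then have "T \<in> closed_submods (3 - i)"
      using dim[OF T(1)] H by (simp add: closed_submods_def)
    then show "H \<in> (`) reduce3 ` closed_submods (3 - i)"
      using T(3) by blast
  next
    fix H assume "H \<in> (`) reduce3 ` closed_submods (3 - i)"
    then obtain T where T: "H = reduce3 ` T" "submod T" "bracket_closed3 T" "size_mod T = nat p ^ (3 - i)"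
      unfolding closed_submods_def by blast
    then have "lie_subalgebra K H LK"
      using lie_subalgebra_iff by blast
    then show "H \<in> lie_subalgebras_of_codim K LK i"
      using dim[OF T(2)] T by (simp add: lie_subalgebras_of_codim_def dim_LK)
  qed
qed

lemma card_lie_subalgebras_of_codim:
  assumes "i \<le> 3"
  shows "card (lie_subalgebras_of_codim K LK i) = card (closed_submods (3 - i))"
proof -
  have "inj_on ((`) reduce3) (closed_submods (3 - i))"
    by (rule inj_on_inverseI[of _ "(-`) reduce3"])
      (simp add: closed_submods_def vimage_reduce3_image)
  then show ?thesis
    by (simp add: lie_subalgebras_of_codim_eq[OF assms] card_image)
qed

lemma subalgebra_zeta_sl2:
  "subalgebra_zeta_mod sl2 (nat p) s =
    (\<Sum>i = 0..3. of_nat (card (closed_submods (3 - i))) * (of_nat (nat p) powr (- s)) ^ i)"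
  using p_pos by (simp add: subalgebra_zeta_mod_def Let_def dim_LK card_lie_subalgebras_of_codim)

end

theorem theorem2p10:
  fixes p :: nat and s t :: complex
  assumes "prime p"
    and "t = of_nat p powr (- s)"
  shows "subalgebra_zeta_mod sl2 p s =
    1 + (1 + of_nat p) * t + (1 + of_nat p + (of_nat p)\<^sup>2) * t ^ 2 + t ^ 3"
proof -
  interpret prime_modulus "int p"
    by unfold_locales (simp add: assms(1))
  \<comment> \<open>Codimensions 0, 1, 2, 3 correspond to dimensions 3, 2, 1, 0: the whole algebra,
    the closed planes, the lines and the zero subspace.\<close>
  have "{0..3} = {0, 1, 2, 3 :: nat}" by auto
  then show ?thesis
    using subalgebra_zeta_sl2[of s] card_closed_submods
    by (simp add: numeral_2_eq_2 numeral_3_eq_3 flip: assms(2))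
qed

end
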